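(* Let $\mathcal R$ and $\mathcal S$ be finite sets with the discrete topology, let $\lambda$ be a probability measure on $\mathcal R\times\mathcal S$ with $\lambda(\mathcal R\times\{s\})>0$ for all $s\in\mathcal S$, and let $\psi\in\mathcal P(\mathcal S)$ be such that $\inf_{\xi\in\mathfrak m^{-1}(\mathcal P(\mathcal R)\times\{\psi\})}H(\xi|\lambda)<\infty$. For all $(\psi_n)_{n\in\mathbb N}$ with $\psi_n\in\mathcal P^n_{emp}(\mathcal S)$ and $\psi_n\to\psi$, the sequence $(\eta_n(\psi_n,\cdot))_{n\in\mathbb N}$ of probability measures on $\mathcal P(\mathcal R)$ satisfies the large deviation principle with rate function $I:\mathcal P(\mathcal R)\to[0,\infty]$ given by $$I(\phi)=\inf_{\xi\in\mathfrak m^{-1}(\{(\phi,\psi)\})}H(\xi|\lambda)\ -\ \inf_{\xi\in\mathfrak m^{-1}(\mathcal P(\mathcal R)\times\{\psi\})}H(\xi|\lambda).$$ Moreover, $I$ is continuous on $\{I<\infty\}$.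
   Context: $\mathcal P(\mathcal X)$ denotes the Borel probability measures on $\mathcal X$; $\mathcal P(\mathcal R),\mathcal P(\mathcal S),\mathcal P(\mathcal R\times\mathcal S)$ carry the weak topology. $H(\xi|\lambda)$ is the relative entropy of $\xi$ with respect to $\lambda$ ($=\infty$ if $\xi\not\ll\lambda$). The infimum over the empty set is $\infty$; $\log0=-\infty$. For a finite set $\mathcal T$ and $t=(t_1,\dots,t_n)\in\mathcal T^n$ put $L_n(t)=\frac1n\sum_{i=1}^n\delta_{t_i}\in\mathcal P(\mathcal T)$, and $\mathcal P^n_{emp}(\mathcal T)=L_n(\mathcal T^n)$. The map $\mathfrak m:\mathcal P(\mathcal R\times\mathcal S)\to\mathcal P(\mathcal R)\times\mathcal P(\mathcal S)$ sends a measure to its pair of marginals: $\mathfrak m(\xi)=(\xi(\cdot\times\mathcal S),\xi(\mathcal R\times\cdot))$. For $s\in\mathcal S$ and $A\subset\mathcal R$ let $\theta(s,A)=\lambda(A\times\mathcal S\,|\,\mathcal R\times\{s\})=\lambda(A\times\{s\})/\lambda(\mathcal R\times\{s\})$. Define $\eta_n:\mathcal P(\mathcal S)\times\mathcal B(\mathcal P(\mathcal R))\to[0,1]$ by $$\eta_n(\xi,A)=\Big[\bigotimes_{i=1}^n\theta(s_i,\cdot)\Big]\big(L_n^{-1}(A)\big)\quad\text{if }\xi=L_n(s_1,\dots,s_n)\in\mathcal P^n_{emp}(\mathcal S),$$ where $L_n$ in $L_n^{-1}(A)$ is the map $\mathcal R^n\to\mathcal P(\mathcal R)$, and $\eta_n(\xi,A)=0$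 if $\xi\notin\mathcal P^n_{emp}(\mathcal S)$. (The value does not depend on the chosen $(s_1,\dots,s_n)$.) Large deviation principle: for a topological space $\mathcal X$, lower semicontinuous $I:\mathcal X\to[0,\infty]$ and probability measures $\mu_n$ on $\mathcal B(\mathcal X)$, $(\mu_n)$ satisfies the large deviation principle with rate function $I$ if for all $A\in\mathcal B(\mathcal X)$: $\liminf_n\frac1n\log\mu_n(A)\ge-\inf I(A^\circ)$ and $\limsup_n\frac1n\log\mu_n(A)\le-\inf I(\overline A)$. *)

theory Defs
  imports "HOL-Probability.Probability"
begin

text \<open>Borel probability measures on a finite discrete space \<open>'a\<close> are the elements of \<open>'a pmf\<close>:
  every subset of \<open>'a\<close> is Borel, and \<^term>\<open>measure_pmf p\<close> is the measure itself.\<close>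

text \<open>The initial topology for the maps \<open>p \<mapsto> \<integral> f dp\<close>. On a finite discrete space
  every real function \<open>f\<close> is bounded and continuous, so no restriction on \<open>f\<close> is needed.\<close>
definition weak_topology :: "'a::finite pmf topology" where
  "weak_topology =
     pullback_topology UNIV (\<lambda>p f. measure_pmf.expectation p f) (powertop_real UNIV)"

definition borel_of_topology :: "'a topology \<Rightarrow> 'a measure" where
  "borel_of_topology X = sigma (topspace X) {U. openin X U}"

text \<open>\<^const>\<open>KL_divergence\<close> \<open>b M N\<close> is the integral of \<open>log b (dN/dM)\<close> with respect to
  \<open>N\<close>. It is real valued; on a finite type the integral always exists when \<open>N\<close> is
  absolutely continuous with respect to \<open>M\<close>.\<close>
definition rel_entropy :: "'a::finite pmf \<Rightarrow> 'a pmf \<Rightarrow> ereal" where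
  "rel_entropy \<xi> lam =
     (if absolutely_continuous (measure_pmf lam) (measure_pmf \<xi>)
      then ereal (KL_divergence (exp 1) (measure_pmf lam) (measure_pmf \<xi>)) else \<infinity>)"

text \<open>Needed because \<^term>\<open>ln (0::real)\<close> is \<open>0\<close> in HOL.\<close>
definition log_prob :: "real \<Rightarrow> ereal" where
  "log_prob x = (if x = 0 then -\<infinity> else ereal (ln x))"

definition lower_semicontinuous :: "'a topology \<Rightarrow> ('a \<Rightarrow> ereal) \<Rightarrow> bool" where
  "lower_semicontinuous X I \<longleftrightarrow> (\<forall>c. closedin X {x \<in> topspace X. I x \<le> c})"

text \<open>Sequences are indexed by \<open>n \<ge> 1\<close>; the value at \<open>0\<close> is irrelevant.\<close>
definition satisfies_LDP :: "'a topology \<Rightarrow> (nat \<Rightarrow> 'a measure) \<Rightarrow> ('a \<Rightarrow> ereal) \<Rightarrow> bool" where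
  "satisfies_LDP X \<mu> I \<longleftrightarrow>
     (\<forall>x \<in> topspace X. 0 \<le> I x) \<and> lower_semicontinuous X I \<and>
     (\<forall>n\<ge>1. prob_space (\<mu> n) \<and> space (\<mu> n) = topspace X \<and>
             sets (\<mu> n) = sets (borel_of_topology X)) \<and>
     (\<forall>A \<in> sets (borel_of_topology X).
        liminf (\<lambda>n. ereal (1 / real n) * log_prob (measure (\<mu> n) A))
          \<ge> - (INF x \<in> X interior_of A. I x) \<and>
        limsup (\<lambda>n. ereal (1 / real n) * log_prob (measure (\<mu> n) A))
          \<le> - (INF x \<in> X closure_of A. I x))"

text \<open>The law of \<open>t I\<close> for an index \<open>I\<close> uniform on \<open>{1..n}\<close>, that is, the average of
  the point masses at \<open>t 1, \<dots>, t n\<close>. Only meaningful for \<open>n \<ge> 1\<close>.\<close>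
definition emp_measure :: "nat \<Rightarrow> (nat \<Rightarrow> 'a) \<Rightarrow> 'a pmf" where
  "emp_measure n t = map_pmf t (pmf_of_set {1..n})"

definition emp_measures :: "nat \<Rightarrow> 'a pmf set" where
  "emp_measures n = emp_measure n ` ({1..n} \<rightarrow>\<^sub>E UNIV)"

definition marginals :: "('r \<times> 's) pmf \<Rightarrow> 'r pmf \<times> 's pmf" where
  "marginals \<xi> = (map_pmf fst \<xi>, map_pmf snd \<xi>)"

definition theta :: "('r \<times> 's) pmf \<Rightarrow> 's \<Rightarrow> 'r pmf" where
  "theta lam s = map_pmf fst (cond_pmf lam (UNIV \<times> {s}))"

definition emp_law :: "('r::finite \<times> 's::finite) pmf \<Rightarrow> nat \<Rightarrow> (nat \<Rightarrow> 's) \<Rightarrow> 'r pmf measure" where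
  "emp_law lam n s =
     distr (\<Pi>\<^sub>M i\<in>{1..n}. measure_pmf (theta lam (s i)))
           (borel_of_topology weak_topology) (emp_measure n)"

text \<open>The choice of \<open>s\<close> does not matter, see \<open>emp_law_cong\<close> and \<open>eta_emp_measure\<close> below.\<close>
definition eta :: "('r::finite \<times> 's::finite) pmf \<Rightarrow> nat \<Rightarrow> 's pmf \<Rightarrow> 'r pmf measure" where
  "eta lam n \<xi> =
     (if \<xi> \<in> emp_measures n
      then emp_law lam n (SOME s. s \<in> {1..n} \<rightarrow>\<^sub>E UNIV \<and> \<xi> = emp_measure n s)
      else null_measure (borel_of_topology weak_topology))"

definition rate :: "('r::finite \<times> 's::finite) pmf \<Rightarrow> 's pmf \<Rightarrow> 'r pmf \<Rightarrow> ereal" where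
  "rate lam \<psi> \<phi> =
     (INF \<xi> \<in> marginals -` {(\<phi>, \<psi>)}. rel_entropy \<xi> lam)
     - (INF \<xi> \<in> marginals -` (UNIV \<times> {\<psi>}). rel_entropy \<xi> lam)"

lemma topspace_weak_topology [simp]: "topspace weak_topology = UNIV"
  by (simp add: weak_topology_def topspace_pullback_topology)

lemma sets_PiM_pmf_finite:
  fixes p :: "'i \<Rightarrow> 'r::finite pmf"
  assumes "finite J"
  shows "sets (\<Pi>\<^sub>M i\<in>J. measure_pmf (p i)) = Pow (J \<rightarrow>\<^sub>E UNIV)"
proof -
  have "sets (\<Pi>\<^sub>M i\<in>J. measure_pmf (p i)) = sets (\<Pi>\<^sub>M i\<in>J. count_space (UNIV :: 'r set))"
    by (intro sets_PiM_cong) auto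
  also have "\<dots> = sets (count_space (J \<rightarrow>\<^sub>E (UNIV :: 'r set)))"
    using assms by (subst count_space_PiM_finite) auto
  finally show ?thesis by simp
qed

lemma measurable_emp_measure:
  fixes p :: "nat \<Rightarrow> 'r::finite pmf"
  shows "emp_measure n \<in> measurable (\<Pi>\<^sub>M i\<in>{1..n}. measure_pmf (p i))
           (borel_of_topology (weak_topology :: 'r pmf topology))"
  by (rule measurableI) (auto simp: sets_PiM_pmf_finite borel_of_topology_def space_PiM space_measure_of_conv)

lemma emeasure_emp_law:
  fixes lam :: "('r::finite \<times> 's::finite) pmf"
  assumes "A \<in> sets (borel_of_topology weak_topology)"
  shows "emeasure (emp_law lam n s) A =
    emeasure (\<Pi>\<^sub>M i\<in>{1..n}. measure_pmf (theta lam (s i)))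
      {r \<in> {1..n} \<rightarrow>\<^sub>E UNIV. emp_measure n r \<in> A}"
  unfolding emp_law_def
  by (subst emeasure_distr[OF measurable_emp_measure assms])
    (auto simp: space_PiM intro!: arg_cong2[where f=emeasure])

lemma emp_measure_eq_imp_permutes:
  assumes "n \<ge> 1" and "emp_measure n s = emp_measure n s'"
  shows "\<exists>\<pi>. \<pi> permutes {1..n} \<and> (\<forall>i\<in>{1..n}. s i = s' (\<pi> i))"
proof -
  have fin: "{1..n} \<noteq> {}" "finite {1..n}" using assms by auto
  have pmf: "pmf (emp_measure n t) x = real (card {i\<in>{1..n}. t i = x}) / real n" for t :: "nat \<Rightarrow> 'a" and x
    unfolding emp_measure_def using fin
    by (simp add: pmf_map measure_pmf_of_set vimage_def Int_def)
  have eq: "card {i\<in>{1..n}. s i = x} = card {i\<in>{1..n}. s' i = x}" for x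
    using pmf[of s x] pmf[of s' x] assms by simp
  have mset: "image_mset s (mset_set {1..n}) = image_mset s' (mset_set {1..n})"
    by (rule multiset_eqI) (use eq in \<open>simp add: count_image_mset_eq_card_vimage\<close>)
  obtain \<pi> where "\<pi> permutes {1..n}" "\<forall>i\<in>{1..n}. s i = s' (\<pi> i)"
    using image_mset_eq_implies_permutes[OF fin(2) mset] by metis
  thus ?thesis by blast
qed

lemma emp_law_cong:
  fixes lam :: "('r::finite \<times> 's::finite) pmf"
  assumes n: "n \<ge> 1" and eq: "emp_measure n s = emp_measure n s'"
  shows "emp_law lam n s = emp_law lam n s'"
proof -
  obtain \<pi> where pi: "\<pi> permutes {1..n}" and s: "\<And>i. i \<in> {1..n} \<Longrightarrow> s i = s' (\<pi> i)"
    using emp_measure_eq_imp_permutes[OF n eq] by blast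
  let ?M = "\<lambda>i. measure_pmf (theta lam (s' i))"
  let ?B = "borel_of_topology (weak_topology :: 'r pmf topology)"
  have img: "\<pi> \<in> {1..n} \<rightarrow> {1..n}" and inj: "inj_on \<pi> {1..n}"
    using pi by (auto simp: permutes_in_image permutes_inj_on simp del: atLeastAtMost_iff)
  have reindex: "(\<Pi>\<^sub>M i\<in>{1..n}. measure_pmf (theta lam (s i))) =
      distr (PiM {1..n} ?M) (\<Pi>\<^sub>M i\<in>{1..n}. measure_pmf (theta lam (s i)))
        (\<lambda>r. \<lambda>i\<in>{1..n}. r (\<pi> i))"
  proof -
    have "distr (PiM {1..n} ?M) (\<Pi>\<^sub>M i\<in>{1..n}. ?M (\<pi> i)) (\<lambda>r. \<lambda>i\<in>{1..n}. r (\<pi> i))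
        = (\<Pi>\<^sub>M i\<in>{1..n}. ?M (\<pi> i))"
      by (rule distr_PiM_reindex[OF _ inj img]) (rule prob_space_measure_pmf)
    moreover have "(\<Pi>\<^sub>M i\<in>{1..n}. measure_pmf (theta lam (s i))) = (\<Pi>\<^sub>M i\<in>{1..n}. ?M (\<pi> i))"
      by (rule PiM_cong) (use s in auto)
    ultimately show ?thesis by simp
  qed
  have meas: "(\<lambda>r. \<lambda>i\<in>{1..n}. r (\<pi> i)) \<in>
      measurable (PiM {1..n} ?M) (\<Pi>\<^sub>M i\<in>{1..n}. measure_pmf (theta lam (s i)))"
    by (rule measurableI) (auto simp: sets_PiM_pmf_finite space_PiM)
  have inv: "emp_measure n (\<lambda>i\<in>{1..n}. r (\<pi> i)) = emp_measure n r" for r :: "nat \<Rightarrow> 'r"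
  proof -
    have "emp_measure n (\<lambda>i\<in>{1..n}. r (\<pi> i)) = map_pmf (r \<circ> \<pi>) (pmf_of_set {1..n})"
      unfolding emp_measure_def using n by (intro map_pmf_cong) auto
    also have "\<dots> = map_pmf r (map_pmf \<pi> (pmf_of_set {1..n}))"
      by (simp add: pmf.map_comp)
    also have "map_pmf \<pi> (pmf_of_set {1..n}) = pmf_of_set {1..n}"
      using n inj permutes_image[OF pi] by (subst map_pmf_of_set_inj) auto
    finally show ?thesis by (simp only: emp_measure_def[of n r])
  qed
  have "emp_law lam n s = distr (distr (PiM {1..n} ?M) (\<Pi>\<^sub>M i\<in>{1..n}. measure_pmf (theta lam (s i)))
        (\<lambda>r. \<lambda>i\<in>{1..n}. r (\<pi> i))) ?B (emp_measure n)"
    unfolding emp_law_def by (subst reindex) (rule refl)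
  also have "\<dots> = emp_law lam n s'"
    by (subst distr_distr[OF measurable_emp_measure meas]) (simp only: emp_law_def comp_def inv)
  finally show ?thesis .
qed

lemma eta_emp_measure:
  fixes lam :: "('r::finite \<times> 's::finite) pmf"
  assumes n: "n \<ge> 1" and s: "s \<in> {1..n} \<rightarrow>\<^sub>E UNIV"
  shows "eta lam n (emp_measure n s) = emp_law lam n s"
proof -
  let ?P = "\<lambda>s'. s' \<in> {1..n} \<rightarrow>\<^sub>E UNIV \<and> emp_measure n s = emp_measure n s'"
  have "?P (Eps ?P)" by (rule someI[of ?P s]) (use s in auto)
  hence "emp_law lam n (Eps ?P) = emp_law lam n s"
    by (metis emp_law_cong n)
  thus ?thesis using s unfolding eta_def emp_measures_def by auto
qed

end

theory Submission
  imports Defs "HOL-Real_Asymp.Real_Asymp"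
begin

text \<open>
  For a joint distribution \<open>w\<close> on \<open>'r \<times> 's\<close> let \<open>D w\<close> be its conditional relative entropy
  (\<open>cond_entropy\<close>): the mean, over \<open>y\<close> drawn from the second marginal, of the relative entropy of
  \<open>w(\<cdot>|y)\<close> with respect to \<open>theta lam y\<close>. The chain rule writes the relative entropy of \<open>w\<close> with
  respect to \<open>lam\<close> as \<open>D w\<close> plus the relative entropy of the second marginals. Prescribing the second
  marginal \<open>\<psi>\<close> fixes the latter, and \<open>D\<close> is nonnegative and vanishes at \<open>w(x, y) = \<psi>(y) theta lam y x\<close>. Hence
  \<^term>\<open>rate lam \<psi> \<phi>\<close> is the minimum of \<open>D\<close> over the couplings of \<open>\<phi>\<close> and \<open>\<psi>\<close> that are absolutely
  continuous with respect to \<open>lam\<close> (\<open>INF_rel_entropy_given_snd\<close>, \<open>rate_le\<close>, \<open>rate_attained\<close>).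

  The large deviation bounds are proved for the joint type of the sample, that is, for the empirical
  measure of the pairs \<open>(r i, s i)\<close>; its first marginal is the empirical measure of interest, and its
  second marginal is the given one. The density between two product laws is a function of the joint
  type (\<open>change_of_measure\<close>). Comparing with the product law built from the conditional laws of a type
  \<open>\<nu>\<close> shows that this type has probability at most \<open>exp (- n * D \<nu>)\<close>. As there are only polynomially
  many types, the upper bound follows, compactness being used to pass from the second marginals
  \<open>\<psi>s n\<close> to their limit \<open>\<psi>\<close> and from a set to its closure (\<open>eventually_cond_entropy_ge\<close>). For the
  lower bound one samples from the conditional laws of a minimising coupling: by Hoeffding's inequality
  the joint type is then close to this coupling, and the price of the change of measure is about
  \<open>exp (- n * D w)\<close>.

  Sublevel sets of the rate function are images of compact sets, which gives lower semicontinuity.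
  Continuity where it is finite uses that the couplings form a polytope and the first marginal is
  linear: a polytope is locally a cone, so a distribution close to \<open>\<phi>\<close> is the first marginal of a
  coupling close to any given coupling over \<open>\<phi>\<close> (\<open>polytope_lipschitz_lift\<close>). Together with the
  continuity of \<open>D\<close> this prevents the minimum from jumping up.
\<close>

section \<open>Probability vectors and the weak topology\<close>

definition pmf_vec :: "'a::finite pmf \<Rightarrow> real^'a" where
  "pmf_vec p = (\<chi> x. pmf p x)"

lemma pmf_vec_nth [simp]: "pmf_vec p $ x = pmf p x"
  by (simp add: pmf_vec_def)

lemma pmf_vec_inject: "pmf_vec p = pmf_vec q \<longleftrightarrow> p = q"
  by (auto simp: vec_eq_iff intro: pmf_eqI)

lemma ex_pmf_vec:
  fixes w :: "real^'a::finite"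
  assumes "\<And>x. 0 \<le> w $ x" and "(\<Sum>x\<in>UNIV. w $ x) = 1"
  shows "\<exists>p. pmf_vec p = w"
proof -
  have "pmf (embed_pmf (($) w)) x = w $ x" for x
    by (rule pmf_embed_pmf)
      (use assms in \<open>auto simp: nn_integral_count_space_finite sum_ennreal\<close>)
  hence "pmf_vec (embed_pmf (($) w)) = w"
    by (simp add: vec_eq_iff)
  thus ?thesis by blast
qed

text \<open>Integration against any function is a linear combination of point masses, and every point
  mass is itself an integral, of an indicator. So the initial topology for all integrals is the
  topology of \<open>real^'a\<close> seen through \<^const>\<open>pmf_vec\<close>, which opens the way to compactness
  and polytope arguments in a Euclidean space.\<close>
lemma weak_topology_eq_pullback:
  "(weak_topology :: 'a::finite pmf topology) = pullback_topology UNIV pmf_vec euclidean"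
proof -
  let ?F = "\<lambda>(p :: 'a pmf) f. measure_pmf.expectation p f"
  define G :: "real^'a \<Rightarrow> ('a \<Rightarrow> real) \<Rightarrow> real" where "G w f = (\<Sum>x\<in>UNIV. f x * w $ x)" for w f
  define E :: "(('a \<Rightarrow> real) \<Rightarrow> real) \<Rightarrow> real^'a" where "E q = (\<chi> x. q (indicator {x}))" for q
  have FG: "?F p = G (pmf_vec p)" for p
    by (auto simp: G_def integral_measure_pmf_real[where A=UNIV] fun_eq_iff)
  have EF: "pmf_vec p = E (?F p)" for p
    by (simp add: E_def vec_eq_iff measure_pmf_single)
  have G: "continuous_map euclidean (powertop_real UNIV) G"
    unfolding continuous_map_componentwise_UNIV
    by (auto simp: G_def intro!: continuous_intros)
  have E: "continuous_map (powertop_real UNIV) euclidean E"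
    unfolding euclidean_product_topology continuous_map_iff_continuous2 E_def
    by (intro continuous_intros continuous_on_product_coordinates)
  have top: "topspace (powertop_real UNIV :: (('a \<Rightarrow> real) \<Rightarrow> real) topology) = UNIV"
    by simp
  show ?thesis
    unfolding topology_eq weak_topology_def openin_pullback_topology
  proof (intro allI iffI; elim exE conjE)
    fix S and U :: "(('a \<Rightarrow> real) \<Rightarrow> real) set"
    assume "openin (powertop_real UNIV) U" and "S = ?F -` U \<inter> UNIV"
    thus "\<exists>V. openin euclidean V \<and> S = pmf_vec -` V \<inter> UNIV"
      by (intro exI[of _ "{w \<in> topspace euclidean. G w \<in> U}"] conjI openin_continuous_map_preimage[OF G])
        (auto simp: FG)
  next
    fix S and U :: "(real^'a) set"
    assume "openin euclidean U" and "S = pmf_vec -` U \<inter> UNIV"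
    thus "\<exists>V. openin (powertop_real UNIV) V \<and> S = ?F -` V \<inter> UNIV"
      by (intro exI[of _ "{q \<in> topspace (powertop_real UNIV). E q \<in> U}"] conjI
          openin_continuous_map_preimage[OF E]) (auto simp: EF)
  qed
qed

lemma openin_weak_topology:
  "openin weak_topology S \<longleftrightarrow> (\<exists>V. open V \<and> S = pmf_vec -` V)"
  by (simp add: weak_topology_eq_pullback openin_pullback_topology)

lemma continuous_map_pmf_vec: "continuous_map weak_topology euclidean pmf_vec"
  by (auto simp: continuous_map_def openin_weak_topology)

lemma closedin_weak_topologyI:
  assumes "closed C"
  shows "closedin weak_topology (pmf_vec -` C)"
  using closedin_continuous_map_preimage[OF continuous_map_pmf_vec, of C] assms by (simp add: vimage_def)

lemma in_closure_of_weak_topologyI: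
  assumes "\<And>n. p n \<in> A" and "(\<lambda>n. pmf_vec (p n)) \<longlonglongrightarrow> pmf_vec q"
  shows "q \<in> weak_topology closure_of A"
proof -
  have "\<exists>y\<in>A. y \<in> T" if T: "q \<in> T" "openin weak_topology T" for T
  proof -
    obtain V where V: "open V" "T = pmf_vec -` V"
      using T by (auto simp: openin_weak_topology)
    then have "eventually (\<lambda>n. pmf_vec (p n) \<in> V) sequentially"
      using assms(2) T by (intro topological_tendstoD) auto
    then obtain n where "pmf_vec (p n) \<in> V"
      by (auto simp: eventually_sequentially)
    then show ?thesis using assms(1) V by auto
  qed
  then show ?thesis by (auto simp: in_closure_of)
qed

lemma limitin_weak_topology_pmf_vec:
  assumes "limitin weak_topology p q sequentially"
  shows "(\<lambda>n. pmf_vec (p n)) \<longlonglongrightarrow> pmf_vec q"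
proof -
  have "limitin euclidean (pmf_vec \<circ> p) (pmf_vec q) sequentially"
    by (rule continuous_map_limit[OF continuous_map_pmf_vec assms])
  then show ?thesis by (simp add: o_def)
qed

section \<open>Relative entropy\<close>

text \<open>Relative entropy as a real function of all vectors. A coordinate with \<open>pmf lam x = 0\<close>
  contributes \<open>0\<close>, as division by \<open>0\<close> gives \<open>0\<close>; so the value is the relative entropy
  only under absolute continuity, but in return it is continuous on the whole orthant. The value
  \<open>\<infinity>\<close> is accounted for separately, by the closed set \<open>dominated\<close> introduced later.\<close>
definition vec_entropy :: "'a::finite pmf \<Rightarrow> real^'a \<Rightarrow> real" where
  "vec_entropy lam w = (\<Sum>x\<in>UNIV. w $ x * ln (w $ x / pmf lam x))"

lemma absolutely_continuous_pmf_iff: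
  "absolutely_continuous (measure_pmf p) (measure_pmf q) \<longleftrightarrow> (\<forall>x. pmf p x = 0 \<longrightarrow> pmf q x = 0)"
proof
  assume ac: "absolutely_continuous (measure_pmf p) (measure_pmf q)"
  show "\<forall>x. pmf p x = 0 \<longrightarrow> pmf q x = 0"
  proof (intro allI impI)
    fix x assume "pmf p x = 0"
    hence "{x} \<in> null_sets (measure_pmf p)" by (simp add: null_sets_def emeasure_pmf_single)
    hence "{x} \<in> null_sets (measure_pmf q)" using ac by (auto simp: absolutely_continuous_def)
    thus "pmf q x = 0" by (simp add: null_sets_def emeasure_pmf_single)
  qed
next
  assume *: "\<forall>x. pmf p x = 0 \<longrightarrow> pmf q x = 0"
  hence sub: "set_pmf q \<subseteq> set_pmf p" by (auto simp: set_pmf_iff)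
  show "absolutely_continuous (measure_pmf p) (measure_pmf q)"
    unfolding absolutely_continuous_def null_sets_def
    using sub by (auto simp: measure_pmf.emeasure_eq_measure measure_pmf_zero_iff)
qed

lemma rel_entropy_eq:
  fixes lam \<xi> :: "'a::finite pmf"
  shows "rel_entropy \<xi> lam =
    (if \<forall>x. pmf lam x = 0 \<longrightarrow> pmf \<xi> x = 0 then ereal (vec_entropy lam (pmf_vec \<xi>)) else \<infinity>)"
proof (cases "\<forall>x. pmf lam x = 0 \<longrightarrow> pmf \<xi> x = 0")
  case True
  interpret sigma_finite_measure "count_space (UNIV :: 'a set)"
    by (rule sigma_finite_measure_count_space_finite) simp
  have dens: "measure_pmf p = density (count_space UNIV) (\<lambda>x. ennreal (pmf p x))" for p :: "'a pmf"
    by (rule measure_pmf_eq_density)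
  have "KL_divergence (exp 1) (measure_pmf lam) (measure_pmf \<xi>) =
      (\<integral>x. pmf \<xi> x * log (exp 1) (pmf \<xi> x / pmf lam x) \<partial>count_space UNIV)"
    unfolding dens
    by (rule KL_density_density) (use True in \<open>auto simp: AE_count_space\<close>)
  also have "\<dots> = vec_entropy lam (pmf_vec \<xi>)"
    by (simp add: lebesgue_integral_count_space_finite vec_entropy_def log_def)
  finally show ?thesis
    using True by (auto simp: rel_entropy_def absolutely_continuous_pmf_iff)
next
  case False
  then show ?thesis by (auto simp: rel_entropy_def absolutely_continuous_pmf_iff)
qed

lemma continuous_on_mult_ln: "continuous_on {0..} (\<lambda>t::real. t * ln (t / c))" if "0 \<le> c"
proof (cases "c = 0")
  case False
  with that have c: "0 < c" by simp
  have "((\<lambda>t. t * ln (t / c)) \<longlongrightarrow> 0) (at_right 0)"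
    using c by real_asymp
  hence 0: "continuous (at 0 within {0..}) (\<lambda>t. t * ln (t / c))"
    by (simp add: continuous_within at_within_Ici_at_right)
  have "continuous (at t within {0..}) (\<lambda>t. t * ln (t / c))" if "t \<in> {0..}" for t
    using 0 that c by (cases "t = 0") (auto intro!: continuous_intros)
  thus ?thesis by (simp add: continuous_on_eq_continuous_within)
qed simp

lemma continuous_on_vec_entropy:
  "continuous_on {w. \<forall>x. 0 \<le> w $ x} (vec_entropy lam)"
  unfolding vec_entropy_def
proof (intro continuous_on_sum)
  fix x :: 'a
  show "continuous_on {w. \<forall>x. 0 \<le> w $ x} (\<lambda>w. w $ x * ln (w $ x / pmf lam x))"
    by (rule continuous_on_compose2[OF continuous_on_mult_ln[of "pmf lam x"], where f="\<lambda>w. w $ x"])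
      (auto intro!: continuous_intros)
qed

section \<open>Minimising over the fibres of a linear map on a polytope\<close>

text \<open>Near \<open>x\<close> only the half-spaces with \<open>x\<close> on their boundary matter, and these are cones
  with apex \<open>x\<close>. Hence every segment from \<open>x\<close> to another point of \<open>S\<close> can be rescaled to a length
  \<open>d\<close> that is the same for all directions. This fails for round convex sets, and it is what makes
  the rate function continuous rather than merely lower semicontinuous.\<close>
lemma polyhedron_locally_conical:
  fixes S :: "'a::euclidean_space set"
  assumes "polyhedron S" and x: "x \<in> S"
  obtains d where "d > 0"
    and "\<And>y t. y \<in> S \<Longrightarrow> 0 \<le> t \<Longrightarrow> t * norm (y - x) \<le> d \<Longrightarrow> x + t *\<^sub>R (y - x) \<in> S"
proof -
  obtain F where F: "finite F" "S = \<Inter>F" and half: "\<And>H. H \<in> F \<Longrightarrow> \<exists>a b. a \<noteq> 0 \<and> H = {x. a \<bullet> x \<le> b}"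
    using assms(1) unfolding polyhedron_def by metis
  have "\<exists>d>0. \<forall>y t. y \<in> H \<longrightarrow> 0 \<le> t \<longrightarrow> t * norm (y - x) \<le> d \<longrightarrow> x + t *\<^sub>R (y - x) \<in> H" if HF: "H \<in> F" for H
  proof -
    obtain a b where a: "a \<noteq> 0" and H: "H = {x. a \<bullet> x \<le> b}"
      using half[OF HF] by blast
    have xb: "a \<bullet> x \<le> b" using x F(2) HF H by auto
    show ?thesis
    \<comment> \<open>An active constraint survives any rescaling; an inactive one has slack to spend.\<close>
    proof (cases "a \<bullet> x = b")
      case True
      show ?thesis
        by (rule exI[of _ 1])
          (auto simp: H inner_add_right inner_diff_right True intro: mult_nonneg_nonpos)
    next
      case False
      let ?d = "(b - a \<bullet> x) / norm a"
      have "a \<bullet> (x + t *\<^sub>R (y - x)) \<le> b" if "0 \<le> t" "t * norm (y - x) \<le> ?d" for y t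
      proof -
        have "t * (a \<bullet> (y - x)) \<le> t * (norm a * norm (y - x))"
          by (intro mult_left_mono norm_cauchy_schwarz that)
        also have "\<dots> \<le> b - a \<bullet> x"
          using that(2) a by (simp add: field_simps)
        finally show ?thesis by (simp add: inner_add_right)
      qed
      then show ?thesis
        using a False xb by (intro exI[of _ ?d]) (auto simp: H)
    qed
  qed
  then obtain d where d: "\<And>H. H \<in> F \<Longrightarrow> d H > 0"
    and step: "\<And>H y t. H \<in> F \<Longrightarrow> y \<in> H \<Longrightarrow> 0 \<le> t \<Longrightarrow> t * norm (y - x) \<le> d H \<Longrightarrow> x + t *\<^sub>R (y - x) \<in> H"
    by metis
  let ?m = "Min (insert 1 (d ` F))"
  show ?thesis
  proof (rule that[of ?m])
    show "?m > 0" using F(1) d by auto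
    fix y t assume *: "y \<in> S" "0 \<le> t" "t * norm (y - x) \<le> ?m"
    have "?m \<le> d H" if "H \<in> F" for H using F(1) that by auto
    then show "x + t *\<^sub>R (y - x) \<in> S"
      using * step unfolding F(2) by (meson InterE InterI order_trans)
  qed
qed

text \<open>A linear map of a polytope onto its image is open: a small step in the image is a small multiple of
  a step of fixed length \<open>d\<close>, which can be lifted somehow, with a displacement bounded by the
  diameter of \<open>P\<close>.\<close>
lemma polytope_lipschitz_lift:
  fixes P :: "'a::euclidean_space set" and f :: "'a \<Rightarrow> 'b::euclidean_space"
  assumes P: "polytope P" and f: "linear f" and w: "w \<in> P"
  obtains C where "C \<ge> 0"
    and "\<And>v. v \<in> f ` P \<Longrightarrow> \<exists>u\<in>P. f u = v \<and> norm (u - w) \<le> C * norm (v - f w)"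
proof -
  have "polyhedron (f ` P)"
    by (intro polytope_imp_polyhedron polytope_linear_image f P)
  from polyhedron_locally_conical[OF this imageI[OF w]] obtain d where d: "d > 0"
    and conic: "\<And>y t. y \<in> f ` P \<Longrightarrow> 0 \<le> t \<Longrightarrow> t * norm (y - f w) \<le> d \<Longrightarrow> f w + t *\<^sub>R (y - f w) \<in> f ` P"
    by metis
  have "bounded ((\<lambda>u. u - w) ` P)"
    using polytope_imp_bounded[OF P] by (rule bounded_translation_minus)
  then obtain D where D: "D > 0" "\<And>u. u \<in> P \<Longrightarrow> norm (u - w) \<le> D"
    unfolding bounded_pos by auto
  show ?thesis
  proof (rule that[of "D / d"])
    show "D / d \<ge> 0" using D d by simp
    fix v assume v: "v \<in> f ` P"
    show "\<exists>u\<in>P. f u = v \<and> norm (u - w) \<le> D / d * norm (v - f w)"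
    \<comment> \<open>For \<open>v\<close> at distance at least \<open>d\<close> the bound is at least \<open>D\<close>, so any lift will do.\<close>
    proof (cases "norm (v - f w) < d")
      case False
      then have "D \<le> D / d * norm (v - f w)"
        using D d by (simp add: field_simps)
      moreover obtain u where "u \<in> P" "f u = v" using v by auto
      ultimately show ?thesis using D(2)[of u] by fastforce
    next
      case small: True
      show ?thesis
      proof (cases "v = f w")
        case True
        then show ?thesis using w by (intro bexI[of _ w]) auto
      next
        case False
        \<comment> \<open>Push \<open>v\<close> away from \<open>f w\<close> to distance \<open>d\<close>, lift, and pull the lift back.\<close>
        define s where "s = norm (v - f w) / d"
        have s: "0 < s" "s \<le> 1" using False small d by (auto simp: s_def)
        have "f w + (1 / s) *\<^sub>R (v - f w) \<in> f ` P"
          using False d s by (intro conic[OF v]) (auto simp: s_def)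
        then obtain u where u: "u \<in> P" "f u = f w + (1 / s) *\<^sub>R (v - f w)" by auto
        have "w + s *\<^sub>R (u - w) = (1 - s) *\<^sub>R w + s *\<^sub>R u"
          by (simp add: algebra_simps)
        then have "w + s *\<^sub>R (u - w) \<in> P"
          using polytope_imp_convex[OF P] w u(1) s by (simp add: convexD)
        moreover have "f (w + s *\<^sub>R (u - w)) = v"
          using s by (simp add: linear_add[OF f] linear_cmul[OF f] linear_diff[OF f] u(2))
        moreover have "norm (s *\<^sub>R (u - w)) \<le> D / d * norm (v - f w)"
          using D(2)[OF u(1)] s d mult_left_mono[of "norm (u - w)" D s] by (simp add: s_def mult.commute)
        ultimately show ?thesis by (intro bexI[of _ "w + s *\<^sub>R (u - w)"]) auto
      qed
    qed
  qed
qed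

lemma fibre_min_attained:
  fixes P :: "'a::euclidean_space set" and f :: "'a \<Rightarrow> 'b::euclidean_space" and h :: "'a \<Rightarrow> real"
  assumes P: "compact P" and f: "linear f" and h: "continuous_on P h" and v: "v \<in> f ` P"
  obtains w where "w \<in> P" "f w = v" "\<And>u. u \<in> P \<Longrightarrow> f u = v \<Longrightarrow> h w \<le> h u"
proof -
  have "closed (f -` {v})"
    by (intro continuous_closed_vimage linear_continuous_at) (use f in \<open>auto simp: linear_conv_bounded_linear\<close>)
  then have "compact (P \<inter> f -` {v})"
    using P by (simp add: compact_Int_closed)
  moreover have "P \<inter> f -` {v} \<noteq> {}" using v by auto
  moreover have "continuous_on (P \<inter> f -` {v}) h"
    using h by (rule continuous_on_subset) auto
  ultimately obtain w where "w \<in> P \<inter> f -` {v}" "\<forall>u\<in>P \<inter> f -` {v}. h w \<le> h u"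
    using continuous_attains_inf by blast
  then show ?thesis using that by auto
qed

text \<open>Upper semicontinuity comes from lifting: nearby fibres contain a point close to a given minimiser.
  Lower semicontinuity comes from compactness: sublevel sets of \<open>g\<close> are images of sublevel sets
  of \<open>h\<close>.\<close>
lemma continuous_on_fibre_min:
  fixes P :: "'a::euclidean_space set" and f :: "'a \<Rightarrow> 'b::euclidean_space" and h :: "'a \<Rightarrow> real"
  assumes P: "polytope P" and f: "linear f" and h: "continuous_on P h"
    and least: "\<And>w. w \<in> P \<Longrightarrow> g (f w) \<le> h w"
    and attained: "\<And>v. v \<in> f ` P \<Longrightarrow> \<exists>w\<in>P. f w = v \<and> g v = h w"
  shows "continuous_on (f ` P) g"
  unfolding continuous_on_def tendsto_iff
proof (intro ballI allI impI)
  fix v and e :: real assume v: "v \<in> f ` P" and e: "0 < e"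
  obtain w where w: "w \<in> P" "f w = v" "g v = h w" using attained[OF v] by blast
  have upper: "eventually (\<lambda>u. g u < g v + e) (at v within f ` P)"
  proof -
    obtain d where d: "d > 0" "\<And>u. u \<in> P \<Longrightarrow> norm (u - w) < d \<Longrightarrow> h u < h w + e"
      using h w(1) e unfolding continuous_on_iff dist_norm
      by (metis abs_diff_less_iff real_norm_def)
    obtain C where C: "C \<ge> 0"
      and lift: "\<And>v. v \<in> f ` P \<Longrightarrow> \<exists>u\<in>P. f u = v \<and> norm (u - w) \<le> C * norm (v - f w)"
      using polytope_lipschitz_lift[OF P f w(1)] by metis
    have "g y < g v + e" if y: "y \<in> f ` P" "dist y v < d / (C + 1)" for y
    proof -
      obtain u where u: "u \<in> P" "f u = y" "norm (u - w) \<le> C * norm (y - v)"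
        using lift[OF y(1)] w(2) by auto
      have "C * norm (y - v) \<le> (C + 1) * norm (y - v)"
        by (intro mult_right_mono) auto
      also have "\<dots> < d"
        using y(2) C by (simp add: dist_norm field_simps)
      finally show ?thesis
        using d(2)[OF u(1)] u least[OF u(1)] w(3) by auto
    qed
    then show ?thesis
      unfolding eventually_at using d(1) C by (intro exI[of _ "d / (C + 1)"]) auto
  qed
  have lower: "eventually (\<lambda>u. g u > g v - e) (at v within f ` P)"
  proof -
    let ?L = "{u \<in> P. h u \<le> g v - e}"
    have "compact ?L"
    proof -
      have "closedin (top_of_set P) (P \<inter> h -` {..g v - e})"
        by (rule continuous_closedin_preimage[OF h closed_atMost])
      then have "closed (P \<inter> h -` {..g v - e})"
        by (rule closedin_closed_trans[OF _ polytope_imp_closed[OF P]])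
      then have "compact (P \<inter> (P \<inter> h -` {..g v - e}))"
        by (rule compact_Int_closed[OF polytope_imp_compact[OF P]])
      also have "P \<inter> (P \<inter> h -` {..g v - e}) = ?L" by auto
      finally show ?thesis .
    qed
    then have "compact (f ` ?L)"
      by (intro compact_continuous_image linear_continuous_on)
        (use f in \<open>simp_all add: linear_conv_bounded_linear\<close>)
    then have "open (- f ` ?L)" using compact_imp_closed by blast
    moreover have "v \<in> - f ` ?L"
      using least e by force
    ultimately have "eventually (\<lambda>u. u \<in> - f ` ?L) (at v within f ` P)"
      unfolding eventually_at_topological by blast
    moreover have "eventually (\<lambda>u. u \<in> f ` P) (at v within f ` P)"
      unfolding eventually_at_topological by (intro exI[of _ UNIV]) auto
    ultimately show ?thesis
    proof eventually_elim
      case (elim u)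
      obtain w' where "w' \<in> P" "f w' = u" "g u = h w'" using attained[OF elim(2)] by blast
      then show ?case using elim(1) by auto
    qed
  qed
  show "eventually (\<lambda>u. dist (g u) (g v) < e) (at v within f ` P)"
    using upper lower by eventually_elim (auto simp: dist_real_def)
qed

section \<open>Couplings and the rate function\<close>

definition fst_marginal :: "real^('r::finite \<times> 's::finite) \<Rightarrow> real^'r" where
  "fst_marginal w = (\<chi> x. \<Sum>y\<in>UNIV. w $ (x, y))"

definition snd_marginal :: "real^('r::finite \<times> 's::finite) \<Rightarrow> real^'s" where
  "snd_marginal w = (\<chi> y. \<Sum>x\<in>UNIV. w $ (x, y))"

lemma fst_marginal_nth [simp]: "fst_marginal w $ x = (\<Sum>y\<in>UNIV. w $ (x, y))"
  by (simp add: fst_marginal_def)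

lemma snd_marginal_nth [simp]: "snd_marginal w $ y = (\<Sum>x\<in>UNIV. w $ (x, y))"
  by (simp add: snd_marginal_def)

lemma linear_fst_marginal: "linear fst_marginal"
  by (rule linearI) (simp_all add: vec_eq_iff sum.distrib sum_distrib_left)

lemma continuous_on_fst_marginal [continuous_intros]:
  "continuous_on A f \<Longrightarrow> continuous_on A (\<lambda>x. fst_marginal (f x))"
  unfolding fst_marginal_def by (intro continuous_intros)

lemma continuous_on_snd_marginal [continuous_intros]:
  "continuous_on A f \<Longrightarrow> continuous_on A (\<lambda>x. snd_marginal (f x))"
  unfolding snd_marginal_def by (intro continuous_intros)

lemma sum_UNIV_prod: "(\<Sum>z\<in>UNIV. f z) = (\<Sum>y\<in>UNIV. \<Sum>x\<in>UNIV. f (x :: 'r::finite, y :: 's::finite))"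
proof -
  have "(\<Sum>z\<in>UNIV. f z) = (\<Sum>x\<in>UNIV. \<Sum>y\<in>UNIV. f (x, y))"
    by (simp add: sum.cartesian_product)
  also have "\<dots> = (\<Sum>y\<in>UNIV. \<Sum>x\<in>UNIV. f (x, y))"
    by (rule sum.swap)
  finally show ?thesis .
qed

lemma pmf_map_fst: "pmf (map_pmf fst \<xi>) x = (\<Sum>y\<in>UNIV. pmf \<xi> (x, y))"
  for \<xi> :: "('r::finite \<times> 's::finite) pmf"
proof -
  have "pmf (map_pmf fst \<xi>) x = measure_pmf.prob \<xi> ((\<lambda>y. (x, y)) ` UNIV)"
    unfolding pmf_map by (rule arg_cong[where f="measure_pmf.prob \<xi>"]) auto
  also have "\<dots> = (\<Sum>y\<in>UNIV. pmf \<xi> (x, y))"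
    by (subst measure_measure_pmf_finite) (auto simp: sum.reindex inj_on_def)
  finally show ?thesis .
qed

lemma pmf_map_snd: "pmf (map_pmf snd \<xi>) y = (\<Sum>x\<in>UNIV. pmf \<xi> (x, y))"
  for \<xi> :: "('r::finite \<times> 's::finite) pmf"
proof -
  have "pmf (map_pmf snd \<xi>) y = measure_pmf.prob \<xi> ((\<lambda>x. (x, y)) ` UNIV)"
    unfolding pmf_map by (rule arg_cong[where f="measure_pmf.prob \<xi>"]) auto
  also have "\<dots> = (\<Sum>x\<in>UNIV. pmf \<xi> (x, y))"
    by (subst measure_measure_pmf_finite) (auto simp: sum.reindex inj_on_def)
  finally show ?thesis .
qed

lemma fst_marginal_pmf_vec: "fst_marginal (pmf_vec \<xi>) = pmf_vec (map_pmf fst \<xi>)"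
  by (simp add: vec_eq_iff pmf_map_fst)

lemma snd_marginal_pmf_vec: "snd_marginal (pmf_vec \<xi>) = pmf_vec (map_pmf snd \<xi>)"
  by (simp add: vec_eq_iff pmf_map_snd)

lemma pmf_le_snd: "pmf \<xi> (x, y) \<le> pmf (map_pmf snd \<xi>) y"
  for \<xi> :: "('r::finite \<times> 's::finite) pmf"
  unfolding pmf_map_snd by (rule member_le_sum[of x UNIV "\<lambda>x. pmf \<xi> (x, y)"]) auto

lemma pmf_theta:
  fixes lam :: "('r::finite \<times> 's::finite) pmf"
  assumes "pmf (map_pmf snd lam) y > 0"
  shows "pmf (theta lam y) x = pmf lam (x, y) / pmf (map_pmf snd lam) y"
proof -
  have prob: "measure_pmf.prob lam (UNIV \<times> {y}) = pmf (map_pmf snd lam) y"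
    unfolding pmf_map by (rule arg_cong[where f="measure_pmf.prob lam"]) auto
  have "set_pmf lam \<inter> (UNIV \<times> {y}) \<noteq> {}"
    using assms by (auto simp flip: prob simp: measure_pmf_zero_iff dest!: less_imp_neq)
  note cond = pmf_cond[OF this]
  have "pmf (theta lam y) x = (\<Sum>y'\<in>UNIV. if y' = y then pmf lam (x, y) / pmf (map_pmf snd lam) y else 0)"
    unfolding theta_def pmf_map_fst by (intro sum.cong) (auto simp: cond prob)
  then show ?thesis by simp
qed

text \<open>The closed cone of nonnegative vectors that vanish where \<open>lam\<close> does. Normalisation is left out:
  for couplings it follows from the prescribed second marginal.\<close>
definition dominated :: "'a::finite pmf \<Rightarrow> (real^'a) set" where
  "dominated lam = {w. \<forall>z. 0 \<le> w $ z \<and> (pmf lam z = 0 \<longrightarrow> w $ z = 0)}"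

text \<open>Only the second marginal is prescribed; the first one is the parameter of the fibres over
  which the rate function minimises.\<close>
definition couplings :: "('r::finite \<times> 's::finite) pmf \<Rightarrow> 's pmf \<Rightarrow> (real^('r \<times> 's)) set" where
  "couplings lam \<psi> = {w \<in> dominated lam. snd_marginal w = pmf_vec \<psi>}"

text \<open>By the chain rule this difference is the conditional relative entropy: the average, over \<open>y\<close>
  drawn from the second marginal of \<open>w\<close>, of the relative entropy of \<open>w(\<cdot>|y)\<close> with respect to
  \<open>theta lam y\<close>; \<open>cond_entropy_eq_sum\<close> below shows this form. The difference makes the continuity
  evident, also where the second marginal vanishes.\<close>
definition cond_entropy :: "('r::finite \<times> 's::finite) pmf \<Rightarrow> real^('r \<times> 's) \<Rightarrow> real" where
  "cond_entropy lam w = vec_entropy lam w - vec_entropy (map_pmf snd lam) (snd_marginal w)"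

lemma pmf_vec_in_dominated:
  "pmf_vec \<xi> \<in> dominated lam \<longleftrightarrow> (\<forall>z. pmf lam z = 0 \<longrightarrow> pmf \<xi> z = 0)"
  by (auto simp: dominated_def)

lemma pmf_vec_in_couplings:
  "pmf_vec \<xi> \<in> couplings lam \<psi> \<longleftrightarrow>
    (\<forall>z. pmf lam z = 0 \<longrightarrow> pmf \<xi> z = 0) \<and> map_pmf snd \<xi> = \<psi>"
  by (auto simp: couplings_def pmf_vec_in_dominated snd_marginal_pmf_vec pmf_vec_inject)

lemma couplings_sum:
  assumes "w \<in> couplings lam \<psi>"
  shows "(\<Sum>z\<in>UNIV. w $ z) = 1"
proof -
  have "(\<Sum>z\<in>UNIV. w $ z) = (\<Sum>y\<in>UNIV. snd_marginal w $ y)"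
    by (simp add: sum_UNIV_prod)
  also have "\<dots> = 1"
    using assms by (simp add: couplings_def sum_pmf_eq_1 del: snd_marginal_nth)
  finally show ?thesis .
qed

lemma couplings_imp_pmf_vec:
  assumes "w \<in> couplings lam \<psi>"
  obtains \<xi> where "w = pmf_vec \<xi>"
  using ex_pmf_vec[of w] couplings_sum[OF assms] assms
  by (force simp: couplings_def dominated_def)

lemma polytope_couplings: "polytope (couplings lam \<psi>)"
proof -
  have eq: "couplings lam \<psi> =
      (\<Inter>z. {w. axis z 1 \<bullet> w \<ge> 0}) \<inter> (\<Inter>z\<in>{z. pmf lam z = 0}. {w. axis z 1 \<bullet> w = 0}) \<inter>
      (\<Inter>y. {w. (\<Sum>x\<in>UNIV. axis (x, y) 1) \<bullet> w = pmf \<psi> y})"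
    by (auto simp: couplings_def dominated_def inner_axis' inner_sum_left vec_eq_iff)
  have "polyhedron (couplings lam \<psi>)"
    unfolding eq
    by (intro polyhedron_Int polyhedron_Inter)
      (auto intro: polyhedron_halfspace_ge polyhedron_hyperplane)
  moreover have "couplings lam \<psi> \<subseteq> cbox 0 1"
  proof
    fix w assume w: "w \<in> couplings lam \<psi>"
    then obtain \<xi> where "w = pmf_vec \<xi>" by (rule couplings_imp_pmf_vec)
    then show "w \<in> cbox 0 1" by (simp add: mem_box_cart pmf_le_1)
  qed
  then have "bounded (couplings lam \<psi>)"
    using bounded_cbox bounded_subset by blast
  ultimately show ?thesis
    by (simp add: polytope_eq_bounded_polyhedron)
qed

lemma closed_dominated: "closed (dominated lam)"
proof -
  have "dominated lam = (\<Inter>z. {w. 0 \<le> w $ z}) \<inter> (\<Inter>z\<in>{z. pmf lam z = 0}. {w. w $ z = 0})"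
    by (auto simp: dominated_def)
  also have "closed \<dots>"
    by (intro closed_Int closed_INT ballI closed_Collect_le closed_Collect_eq continuous_intros)
  finally show ?thesis .
qed

lemma continuous_on_cond_entropy: "continuous_on (dominated lam) (cond_entropy lam)"
  unfolding cond_entropy_def
  by (intro continuous_on_diff continuous_on_compose2[OF continuous_on_vec_entropy] continuous_intros
      continuous_on_subset[OF continuous_on_vec_entropy])
    (auto simp: dominated_def intro!: sum_nonneg)

lemma couplings_subset_dominated: "couplings lam \<psi> \<subseteq> dominated lam"
  by (auto simp: couplings_def)

lemma le_snd_marginal:
  assumes "w \<in> dominated lam"
  shows "w $ (x, y) \<le> snd_marginal w $ y"
  unfolding snd_marginal_nth
  by (rule member_le_sum[of x UNIV "\<lambda>x. w $ (x, y)"]) (use assms in \<open>auto simp: dominated_def\<close>)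

lemma cond_entropy_eq_sum:
  assumes w: "w \<in> dominated lam"
  shows "cond_entropy lam w = (\<Sum>z\<in>UNIV. w $ z *
    ln ((w $ z / snd_marginal w $ snd z) / (pmf lam z / pmf (map_pmf snd lam) (snd z))))"
    (is "_ = (\<Sum>z\<in>UNIV. ?f z)")
proof -
  have "?f z = w $ z * ln (w $ z / pmf lam z)
      - w $ z * ln (snd_marginal w $ snd z / pmf (map_pmf snd lam) (snd z))" for z
  proof (cases "w $ z = 0")
    case False
    obtain x y where z: "z = (x, y)" by force
    have pos: "0 < w $ (x, y)" "0 < pmf lam (x, y)"
      using False w z by (auto simp: dominated_def less_le)
    have "w $ (x, y) \<le> snd_marginal w $ y" by (rule le_snd_marginal[OF w])
    then have "0 < snd_marginal w $ y" using pos by linarith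
    moreover have "0 < pmf (map_pmf snd lam) y" using pmf_le_snd[of lam x y] pos by linarith
    ultimately show ?thesis
      using pos by (simp add: z ln_div ln_mult algebra_simps del: snd_marginal_nth)
  qed simp
  then have "(\<Sum>z\<in>UNIV. ?f z) = vec_entropy lam w
      - (\<Sum>z\<in>UNIV. w $ z * ln (snd_marginal w $ snd z / pmf (map_pmf snd lam) (snd z)))"
    by (simp add: sum_subtractf vec_entropy_def)
  also have "(\<Sum>z\<in>UNIV. w $ z * ln (snd_marginal w $ snd z / pmf (map_pmf snd lam) (snd z)))
      = vec_entropy (map_pmf snd lam) (snd_marginal w)"
    unfolding sum_UNIV_prod by (simp add: vec_entropy_def flip: sum_distrib_right)
  finally show ?thesis by (simp add: cond_entropy_def)
qed

text \<open>Gibbs' inequality for the conditional laws: \<open>ln t \<ge> 1 - 1/t\<close> bounds each term below by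
  \<open>w z - q z\<close>, where \<open>q\<close> has the conditional laws of \<open>lam\<close> and the second marginal of \<open>w\<close>; both have
  the same total mass.\<close>
lemma cond_entropy_nonneg:
  assumes w: "w \<in> dominated lam" and pos: "\<And>y. pmf (map_pmf snd lam) y > 0"
  shows "cond_entropy lam w \<ge> 0"
proof -
  let ?q = "\<lambda>z. pmf lam z * snd_marginal w $ snd z / pmf (map_pmf snd lam) (snd z)"
  have "w $ z * ln ((w $ z / snd_marginal w $ snd z) / (pmf lam z / pmf (map_pmf snd lam) (snd z)))
      \<ge> w $ z - ?q z" for z
  proof (cases "w $ z = 0")
    case True
    have "0 \<le> snd_marginal w $ snd z" using w by (auto simp: dominated_def intro!: sum_nonneg)
    then show ?thesis using True by (auto intro!: divide_nonneg_nonneg mult_nonneg_nonneg simp del: snd_marginal_nth)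
  next
    case False
    obtain x y where z: "z = (x, y)" by force
    have p: "0 < w $ (x, y)" "0 < pmf lam (x, y)"
      using False w z by (auto simp: dominated_def less_le)
    have "w $ (x, y) \<le> snd_marginal w $ y" by (rule le_snd_marginal[OF w])
    then have s: "0 < snd_marginal w $ y" using p by linarith
    let ?t = "(w $ z / snd_marginal w $ snd z) / (pmf lam z / pmf (map_pmf snd lam) (snd z))"
    have t: "0 < ?t" using p s pos[of y] by (simp add: z del: snd_marginal_nth)
    then have "ln (inverse ?t) \<le> inverse ?t - 1" by (intro ln_le_minus_one) (rule positive_imp_inverse_positive)
    then have "1 - inverse ?t \<le> ln ?t" unfolding ln_inverse by linarith
    then have "w $ z * ln ?t \<ge> w $ z * (1 - inverse ?t)"
      using p by (intro mult_left_mono) (auto simp: z)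
    also have "w $ z * (1 - inverse ?t) = w $ z - ?q z"
      using p s pos[of y] by (simp add: z field_simps del: snd_marginal_nth)
    finally show ?thesis .
  qed
  then have "(\<Sum>z\<in>UNIV. w $ z - ?q z) \<le> cond_entropy lam w"
    unfolding cond_entropy_eq_sum[OF w] by (intro sum_mono)
  moreover have "(\<Sum>x\<in>UNIV. ?q (x, y)) = snd_marginal w $ y" for y
    using pos[of y]
    by (simp add: pmf_map_snd less_imp_neq[symmetric] del: snd_marginal_nth flip: sum_distrib_right sum_divide_distrib)
  then have "(\<Sum>z\<in>UNIV. w $ z - ?q z) = 0"
    by (simp add: sum_subtractf sum_UNIV_prod)
  ultimately show ?thesis by simp
qed

lemma pmf_bind_Pair:
  "pmf (bind_pmf \<psi> (\<lambda>y. map_pmf (\<lambda>x. (x, y)) (\<kappa> y))) (x, y) = pmf \<psi> y * pmf (\<kappa> y) x"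
  for \<psi> :: "'s::finite pmf" and \<kappa> :: "'s \<Rightarrow> 'r pmf"
proof -
  have "pmf (map_pmf (\<lambda>x. (x, y')) (\<kappa> y')) (x, y) = (if y' = y then pmf (\<kappa> y) x else 0)" for y'
    by (auto simp: pmf_map vimage_def measure_pmf_single)
  then show ?thesis
    by (simp add: pmf_bind integral_measure_pmf_real[where A=UNIV] if_distrib[of "\<lambda>t. t * _"] cong: if_cong)
qed

lemma map_snd_bind_Pair:
  "map_pmf snd (bind_pmf \<psi> (\<lambda>y. map_pmf (\<lambda>x. (x, y)) (\<kappa> y))) = \<psi>"
  by (simp add: map_bind_pmf pmf.map_comp o_def bind_return_pmf')

text \<open>The infimum is attained by drawing \<open>y\<close> from \<open>\<psi>\<close> and then \<open>x\<close> from \<open>theta lam y\<close>, for which the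
  conditional entropy vanishes.\<close>
lemma INF_rel_entropy_given_snd:
  fixes lam :: "('r::finite \<times> 's::finite) pmf"
  assumes pos: "\<And>y. pmf (map_pmf snd lam) y > 0"
  shows "(INF \<xi> \<in> marginals -` (UNIV \<times> {\<psi>}). rel_entropy \<xi> lam)
    = ereal (vec_entropy (map_pmf snd lam) (pmf_vec \<psi>))"
proof (rule antisym)
  let ?\<xi> = "bind_pmf \<psi> (\<lambda>y. map_pmf (\<lambda>x. (x, y)) (theta lam y))"
  have p: "pmf ?\<xi> (x, y) = pmf \<psi> y * (pmf lam (x, y) / pmf (map_pmf snd lam) y)" for x y
    by (simp add: pmf_bind_Pair pmf_theta pos)
  have dom: "\<forall>z. pmf lam z = 0 \<longrightarrow> pmf ?\<xi> z = 0"
    by (auto simp: p)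
  have snd: "map_pmf snd ?\<xi> = \<psi>" by (rule map_snd_bind_Pair)
  have "cond_entropy lam (pmf_vec ?\<xi>) = 0"
    unfolding cond_entropy_eq_sum[OF pmf_vec_in_dominated[THEN iffD2, OF dom]] snd_marginal_pmf_vec snd
    by (auto simp: p intro!: sum.neutral)
  then have "rel_entropy ?\<xi> lam = ereal (vec_entropy (map_pmf snd lam) (pmf_vec \<psi>))"
    using dom by (simp add: rel_entropy_eq cond_entropy_def snd_marginal_pmf_vec snd)
  then show "(INF \<xi> \<in> marginals -` (UNIV \<times> {\<psi>}). rel_entropy \<xi> lam)
      \<le> ereal (vec_entropy (map_pmf snd lam) (pmf_vec \<psi>))"
    by (intro INF_lower2[of ?\<xi>]) (auto simp: marginals_def snd)
next
  show "ereal (vec_entropy (map_pmf snd lam) (pmf_vec \<psi>))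
      \<le> (INF \<xi> \<in> marginals -` (UNIV \<times> {\<psi>}). rel_entropy \<xi> lam)"
  proof (rule INF_greatest)
    fix \<xi> :: "('r \<times> 's) pmf" assume "\<xi> \<in> marginals -` (UNIV \<times> {\<psi>})"
    then have "map_pmf snd \<xi> = \<psi>" by (simp add: marginals_def)
    then show "ereal (vec_entropy (map_pmf snd lam) (pmf_vec \<psi>)) \<le> rel_entropy \<xi> lam"
      using cond_entropy_nonneg[of "pmf_vec \<xi>" lam, OF _ pos]
      by (auto simp: rel_entropy_eq cond_entropy_def snd_marginal_pmf_vec pmf_vec_in_dominated)
  qed
qed

text \<open>Together with \<open>rate_attained\<close>: the rate function is the minimum of \<^const>\<open>cond_entropy\<close> over the
  couplings with first marginal \<open>\<phi>\<close>, because the subtracted infimum is exactly the entropy of the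
  second marginal.\<close>
lemma rate_le:
  fixes lam :: "('r::finite \<times> 's::finite) pmf"
  assumes pos: "\<And>y. pmf (map_pmf snd lam) y > 0"
    and w: "w \<in> couplings lam \<psi>" "fst_marginal w = pmf_vec \<phi>"
  shows "rate lam \<psi> \<phi> \<le> ereal (cond_entropy lam w)"
proof -
  obtain \<xi> where \<xi>: "w = pmf_vec \<xi>" using w(1) by (rule couplings_imp_pmf_vec)
  have m: "map_pmf fst \<xi> = \<phi>" "map_pmf snd \<xi> = \<psi>" and dom: "\<forall>z. pmf lam z = 0 \<longrightarrow> pmf \<xi> z = 0"
    using w by (auto simp: \<xi> pmf_vec_in_couplings fst_marginal_pmf_vec pmf_vec_inject)
  have "(INF \<xi> \<in> marginals -` {(\<phi>, \<psi>)}. rel_entropy \<xi> lam) \<le> rel_entropy \<xi> lam"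
    by (rule INF_lower) (simp add: marginals_def m)
  also have "\<dots> = ereal (vec_entropy lam w)"
    using dom by (simp add: rel_entropy_eq \<xi>)
  finally have "rate lam \<psi> \<phi> \<le> ereal (vec_entropy lam w) - ereal (vec_entropy (map_pmf snd lam) (pmf_vec \<psi>))"
    unfolding rate_def INF_rel_entropy_given_snd[OF pos] by (intro ereal_minus_mono) auto
  then show ?thesis
    using w(1) by (simp add: cond_entropy_def couplings_def)
qed

text \<open>The minimum exists because the couplings form a compact set and \<^const>\<open>cond_entropy\<close> is continuous
  there.\<close>
lemma rate_attained:
  fixes lam :: "('r::finite \<times> 's::finite) pmf"
  assumes pos: "\<And>y. pmf (map_pmf snd lam) y > 0" and fin: "rate lam \<psi> \<phi> < \<infinity>"
  obtains w where "w \<in> couplings lam \<psi>" "fst_marginal w = pmf_vec \<phi>"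
    "rate lam \<psi> \<phi> = ereal (cond_entropy lam w)"
proof -
  let ?I = "INF \<xi> \<in> marginals -` {(\<phi>, \<psi>)}. rel_entropy \<xi> lam"
  have "?I < \<infinity>"
    using fin unfolding rate_def INF_rel_entropy_given_snd[OF pos] by (cases ?I) auto
  then obtain \<xi> where \<xi>: "\<xi> \<in> marginals -` {(\<phi>, \<psi>)}" "rel_entropy \<xi> lam < \<infinity>"
    unfolding INF_less_iff by blast
  then have "pmf_vec \<phi> \<in> fst_marginal ` couplings lam \<psi>"
    by (intro image_eqI[of _ _ "pmf_vec \<xi>"])
      (auto simp: marginals_def fst_marginal_pmf_vec pmf_vec_in_couplings rel_entropy_eq split: if_splits)
  then obtain w where w: "w \<in> couplings lam \<psi>" "fst_marginal w = pmf_vec \<phi>"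
    and min: "\<And>u. u \<in> couplings lam \<psi> \<Longrightarrow> fst_marginal u = pmf_vec \<phi> \<Longrightarrow> cond_entropy lam w \<le> cond_entropy lam u"
    using fibre_min_attained[OF polytope_imp_compact[OF polytope_couplings] linear_fst_marginal
        continuous_on_subset[OF continuous_on_cond_entropy couplings_subset_dominated]]
    by metis
  have "ereal (vec_entropy lam w) \<le> ?I"
  proof (rule INF_greatest)
    fix \<xi> assume "\<xi> \<in> marginals -` {(\<phi>, \<psi>)}"
    then have m: "map_pmf fst \<xi> = \<phi>" "map_pmf snd \<xi> = \<psi>" by (simp_all add: marginals_def)
    show "ereal (vec_entropy lam w) \<le> rel_entropy \<xi> lam"
      using min[of "pmf_vec \<xi>"] w(1)
      by (auto simp: rel_entropy_eq pmf_vec_in_couplings fst_marginal_pmf_vec snd_marginal_pmf_vec m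
          pmf_vec_in_dominated cond_entropy_def couplings_def)
  qed
  then have "ereal (vec_entropy lam w) - ereal (vec_entropy (map_pmf snd lam) (pmf_vec \<psi>)) \<le> rate lam \<psi> \<phi>"
    unfolding rate_def INF_rel_entropy_given_snd[OF pos] by (intro ereal_minus_mono) auto
  then have "ereal (cond_entropy lam w) \<le> rate lam \<psi> \<phi>"
    using w(1) by (simp add: cond_entropy_def couplings_def)
  then show ?thesis
    using that[OF w] rate_le[OF pos w] by (simp add: antisym)
qed

lemma rate_nonneg:
  fixes lam :: "('r::finite \<times> 's::finite) pmf"
  assumes pos: "\<And>y. pmf (map_pmf snd lam) y > 0"
  shows "0 \<le> rate lam \<psi> \<phi>"
proof (cases "rate lam \<psi> \<phi> < \<infinity>")
  case True
  then obtain w where "w \<in> couplings lam \<psi>" "rate lam \<psi> \<phi> = ereal (cond_entropy lam w)"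
    using rate_attained[OF pos] by metis
  then show ?thesis
    using cond_entropy_nonneg[OF _ pos] couplings_subset_dominated by fastforce
qed auto

lemma rate_finite_iff:
  fixes lam :: "('r::finite \<times> 's::finite) pmf"
  assumes pos: "\<And>y. pmf (map_pmf snd lam) y > 0"
  shows "rate lam \<psi> \<phi> < \<infinity> \<longleftrightarrow> pmf_vec \<phi> \<in> fst_marginal ` couplings lam \<psi>"
proof
  assume "rate lam \<psi> \<phi> < \<infinity>"
  then show "pmf_vec \<phi> \<in> fst_marginal ` couplings lam \<psi>"
    using rate_attained[OF pos] by (metis image_eqI)
next
  assume "pmf_vec \<phi> \<in> fst_marginal ` couplings lam \<psi>"
  then obtain w where "w \<in> couplings lam \<psi>" "fst_marginal w = pmf_vec \<phi>" by (metis imageE)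
  then have "rate lam \<psi> \<phi> \<le> ereal (cond_entropy lam w)" by (rule rate_le[OF pos])
  then show "rate lam \<psi> \<phi> < \<infinity>" by (rule le_less_trans) simp
qed

text \<open>Real sublevel sets are images, under the first marginal, of compact sets of couplings.\<close>
lemma lower_semicontinuous_rate:
  fixes lam :: "('r::finite \<times> 's::finite) pmf"
  assumes pos: "\<And>y. pmf (map_pmf snd lam) y > 0"
  shows "lower_semicontinuous weak_topology (rate lam \<psi>)"
  unfolding lower_semicontinuous_def
proof
  fix c :: ereal
  show "closedin weak_topology {\<phi> \<in> topspace weak_topology. rate lam \<psi> \<phi> \<le> c}"
  proof (cases c)
    case (real r)
    let ?L = "couplings lam \<psi> \<inter> cond_entropy lam -` {..r}"
    have "{\<phi>. rate lam \<psi> \<phi> \<le> c} = pmf_vec -` (fst_marginal ` ?L)"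
    proof (intro set_eqI iffI)
      fix \<phi> assume "\<phi> \<in> {\<phi>. rate lam \<psi> \<phi> \<le> c}"
      then have le: "rate lam \<psi> \<phi> \<le> ereal r" using real by simp
      then have "rate lam \<psi> \<phi> < \<infinity>" by auto
      then obtain w where "w \<in> couplings lam \<psi>" "fst_marginal w = pmf_vec \<phi>"
        "rate lam \<psi> \<phi> = ereal (cond_entropy lam w)"
        using rate_attained[OF pos] by metis
      then show "\<phi> \<in> pmf_vec -` (fst_marginal ` ?L)" using le by (auto intro!: image_eqI[of _ _ w])
    next
      fix \<phi> assume "\<phi> \<in> pmf_vec -` (fst_marginal ` ?L)"
      then obtain w where "w \<in> couplings lam \<psi>" "fst_marginal w = pmf_vec \<phi>" "cond_entropy lam w \<le> r"
        by auto
      then show "\<phi> \<in> {\<phi>. rate lam \<psi> \<phi> \<le> c}"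
        using rate_le[OF pos, of w \<psi> \<phi>] real by (auto intro: order_trans)
    qed
    moreover have "compact ?L"
    proof -
      have P: "compact (couplings lam \<psi>)"
        by (rule polytope_imp_compact[OF polytope_couplings])
      have "closedin (top_of_set (couplings lam \<psi>)) ?L"
        by (intro continuous_closedin_preimage closed_atMost
            continuous_on_subset[OF continuous_on_cond_entropy couplings_subset_dominated])
      then show ?thesis using P by (rule closedin_compact[rotated])
    qed
    then have "closed (fst_marginal ` ?L)"
      by (intro compact_imp_closed compact_continuous_image linear_continuous_on)
        (simp_all add: linear_fst_marginal flip: linear_conv_bounded_linear)
    ultimately show ?thesis by (simp add: closedin_weak_topologyI)
  next
    case PInf
    then show ?thesis by (simp add: closedin_topspace[of weak_topology, simplified])
  next
    case MInf
    have "\<not> rate lam \<psi> \<phi> \<le> -\<infinity>" for \<phi>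
      using rate_nonneg[OF pos, of \<psi> \<phi>] by auto
    then have "{\<phi>. rate lam \<psi> \<phi> \<le> c} = {}"
      using MInf by auto
    then show ?thesis by simp
  qed
qed

text \<open>On the set where it is finite the rate function is the fibrewise minimum of a continuous function
  over the polytope of couplings.\<close>
lemma continuous_map_rate:
  fixes lam :: "('r::finite \<times> 's::finite) pmf"
  assumes pos: "\<And>y. pmf (map_pmf snd lam) y > 0"
  shows "continuous_map (subtopology weak_topology {\<phi>. rate lam \<psi> \<phi> < \<infinity>}) euclidean (rate lam \<psi>)"
proof -
  let ?Q = "fst_marginal ` couplings lam \<psi>"
  define g where "g v = real_of_ereal (rate lam \<psi> (inv pmf_vec v))" for v
  have inv: "inv pmf_vec (pmf_vec \<phi>) = \<phi>" for \<phi> :: "'r pmf"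
    by (simp add: inv_f_f inj_def pmf_vec_inject)
  have g: "rate lam \<psi> \<phi> = ereal (g (pmf_vec \<phi>))" if "rate lam \<psi> \<phi> < \<infinity>" for \<phi>
    using rate_attained[OF pos that] by (metis g_def inv real_of_ereal.simps(1))
  have im: "\<exists>\<phi>. fst_marginal w = pmf_vec \<phi>" if "w \<in> couplings lam \<psi>" for w
    using couplings_imp_pmf_vec[OF that] by (metis fst_marginal_pmf_vec)
  have "continuous_on ?Q g"
  proof (rule continuous_on_fibre_min[OF polytope_couplings linear_fst_marginal
        continuous_on_subset[OF continuous_on_cond_entropy couplings_subset_dominated]])
    fix w assume w: "w \<in> couplings lam \<psi>"
    then obtain \<phi> where \<phi>: "fst_marginal w = pmf_vec \<phi>" using im by blast
    have "rate lam \<psi> \<phi> < \<infinity>" using w \<phi> by (metis rate_finite_iff[OF pos] image_eqI)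
    then have "rate lam \<psi> \<phi> = ereal (g (fst_marginal w))" unfolding \<phi> by (rule g)
    then show "g (fst_marginal w) \<le> cond_entropy lam w"
      using rate_le[OF pos w \<phi>] by simp
  next
    fix v assume v: "v \<in> ?Q"
    then obtain \<phi> where \<phi>: "v = pmf_vec \<phi>" using im by (metis imageE)
    then have fin: "rate lam \<psi> \<phi> < \<infinity>" using v unfolding \<phi> by (intro rate_finite_iff[OF pos, THEN iffD2])
    then show "\<exists>w\<in>couplings lam \<psi>. fst_marginal w = v \<and> g v = cond_entropy lam w"
      using rate_attained[OF pos fin] g \<phi> by (metis ereal.inject)
  qed
  then have "continuous_map (top_of_set ?Q) euclidean (\<lambda>v. ereal (g v))"
    by (simp add: continuous_on_ereal)
  moreover have "continuous_map (subtopology weak_topology {\<phi>. rate lam \<psi> \<phi> < \<infinity>}) (top_of_set ?Q) pmf_vec"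
    unfolding continuous_map_in_subtopology
    by (intro conjI continuous_map_from_subtopology continuous_map_pmf_vec)
      (use rate_finite_iff[OF pos, of \<psi>] in auto)
  ultimately have "continuous_map (subtopology weak_topology {\<phi>. rate lam \<psi> \<phi> < \<infinity>}) euclidean
      ((\<lambda>v. ereal (g v)) \<circ> pmf_vec)"
    by (rule continuous_map_compose[rotated])
  then show ?thesis
    by (rule continuous_map_eq) (simp add: g)
qed

section \<open>Product laws and joint types\<close>

abbreviation product_law :: "('s \<Rightarrow> 'r pmf) \<Rightarrow> nat \<Rightarrow> (nat \<Rightarrow> 's) \<Rightarrow> (nat \<Rightarrow> 'r) measure" where
  "product_law \<kappa> n s \<equiv> \<Pi>\<^sub>M i\<in>{1..n}. measure_pmf (\<kappa> (s i))"

abbreviation joint_type :: "nat \<Rightarrow> (nat \<Rightarrow> 'r) \<Rightarrow> (nat \<Rightarrow> 's) \<Rightarrow> ('r \<times> 's) pmf" where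
  "joint_type n r s \<equiv> emp_measure n (\<lambda>i. (r i, s i))"

lemma map_fst_joint_type: "map_pmf fst (joint_type n r s) = emp_measure n r"
  by (simp add: emp_measure_def pmf.map_comp o_def)

lemma map_snd_joint_type: "map_pmf snd (joint_type n r s) = emp_measure n s"
  by (simp add: emp_measure_def pmf.map_comp o_def)

lemma pmf_emp_measure:
  assumes "n \<ge> 1"
  shows "pmf (emp_measure n t) x = real (card {i\<in>{1..n}. t i = x}) / real n"
  using assms by (simp add: emp_measure_def pmf_map measure_pmf_of_set vimage_def Int_def)

lemma pmf_emp_measure_pos:
  assumes "i \<in> {1..n}"
  shows "pmf (emp_measure n t) (t i) > 0"
proof -
  have "{1..n} \<noteq> {}" using assms by blast
  then have "t i \<in> set_pmf (emp_measure n t)"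
    unfolding emp_measure_def using assms by (auto simp: set_pmf_of_set)
  then show ?thesis by (rule pmf_positive)
qed

text \<open>The log-density of a product law is additive over the sample, hence linear in the joint type.\<close>
lemma sum_emp_measure:
  fixes t :: "nat \<Rightarrow> 'a::finite" and f :: "'a \<Rightarrow> real"
  assumes "n \<ge> 1"
  shows "(\<Sum>i\<in>{1..n}. f (t i)) = real n * (\<Sum>z\<in>UNIV. pmf (emp_measure n t) z * f z)"
proof -
  have ne: "{1..n} \<noteq> {}" using assms by auto
  have "(\<Sum>z\<in>UNIV. pmf (emp_measure n t) z * f z) = measure_pmf.expectation (emp_measure n t) f"
    by (simp add: integral_measure_pmf_real[where A=UNIV] mult.commute)
  also have "\<dots> = (\<Sum>i\<in>{1..n}. f (t i)) / real n"
    unfolding emp_measure_def using ne by (simp add: integral_pmf_of_set)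
  finally show ?thesis using assms by simp
qed

lemma measure_product_law:
  fixes \<kappa> :: "'s \<Rightarrow> 'r::finite pmf"
  assumes B: "B \<subseteq> {1..n} \<rightarrow>\<^sub>E UNIV"
  shows "measure (product_law \<kappa> n s) B = (\<Sum>r\<in>B. \<Prod>i\<in>{1..n}. pmf (\<kappa> (s i)) (r i))"
proof -
  interpret P: finite_product_prob_space "\<lambda>i. measure_pmf (\<kappa> (s i))" "{1..n}"
    by unfold_locales simp
  have fin: "finite B"
    using B finite_PiE[of "{1..n}" "\<lambda>_. UNIV :: 'r set"] by (auto intro: finite_subset)
  have "measure (product_law \<kappa> n s) B = (\<Sum>r\<in>B. measure (product_law \<kappa> n s) {r})"
    by (rule P.finite_measure_eq_sum_singleton[OF fin]) (use B in \<open>auto simp: sets_PiM_pmf_finite\<close>)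
  also have "\<dots> = (\<Sum>r\<in>B. \<Prod>i\<in>{1..n}. pmf (\<kappa> (s i)) (r i))"
  proof (intro sum.cong refl)
    fix r assume "r \<in> B"
    then have "{r} = (\<Pi>\<^sub>E i\<in>{1..n}. {r i})" using B by (intro PiE_singleton[symmetric]) (auto simp: PiE_def)
    then have "measure (product_law \<kappa> n s) {r} = measure (product_law \<kappa> n s) (\<Pi>\<^sub>E i\<in>{1..n}. {r i})"
      by simp
    also have "\<dots> = (\<Prod>i\<in>{1..n}. pmf (\<kappa> (s i)) (r i))"
      by (subst P.prob_times) (auto simp: measure_pmf_single)
    finally show "measure (product_law \<kappa> n s) {r} = (\<Prod>i\<in>{1..n}. pmf (\<kappa> (s i)) (r i))" .
  qed
  finally show ?thesis .
qed

lemma prob_space_product_law: "prob_space (product_law \<kappa> n s)"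
  by (intro prob_space_PiM prob_space_measure_pmf)

text \<open>Grouping the factors by the value of \<open>(r i, s i)\<close> shows that the density between two product laws is a
  function of the joint type, and that its logarithm is linear in it.\<close>
lemma change_of_measure:
  fixes \<kappa> \<theta> :: "'s::finite \<Rightarrow> 'r::finite pmf"
  assumes n: "n \<ge> 1" and \<kappa>: "\<And>i. i \<in> {1..n} \<Longrightarrow> pmf (\<kappa> (s i)) (r i) > 0"
    and \<theta>: "\<And>i. i \<in> {1..n} \<Longrightarrow> pmf (\<theta> (s i)) (r i) > 0"
  shows "(\<Prod>i\<in>{1..n}. pmf (\<theta> (s i)) (r i)) = (\<Prod>i\<in>{1..n}. pmf (\<kappa> (s i)) (r i)) *
    exp (- real n * (\<Sum>z\<in>UNIV. pmf (joint_type n r s) z * ln (pmf (\<kappa> (snd z)) (fst z) / pmf (\<theta> (snd z)) (fst z))))"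
proof -
  let ?F = "\<lambda>z. ln (pmf (\<kappa> (snd z)) (fst z) / pmf (\<theta> (snd z)) (fst z))"
  have "(\<Prod>i\<in>{1..n}. pmf (\<theta> (s i)) (r i)) = (\<Prod>i\<in>{1..n}. pmf (\<kappa> (s i)) (r i) * exp (- ?F (r i, s i)))"
  proof (intro prod.cong refl)
    fix i assume i: "i \<in> {1..n}"
    show "pmf (\<theta> (s i)) (r i) = pmf (\<kappa> (s i)) (r i) * exp (- ?F (r i, s i))"
      using \<kappa>[OF i] \<theta>[OF i] by (simp add: exp_minus)
  qed
  also have "\<dots> = (\<Prod>i\<in>{1..n}. pmf (\<kappa> (s i)) (r i)) * exp (- (\<Sum>i\<in>{1..n}. ?F (r i, s i)))"
    by (simp add: prod.distrib exp_sum flip: sum_negf)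
  also have "(\<Sum>i\<in>{1..n}. ?F (r i, s i)) = real n * (\<Sum>z\<in>UNIV. pmf (joint_type n r s) z * ?F z)"
    by (rule sum_emp_measure[OF n, of ?F "\<lambda>i. (r i, s i)"])
  finally show ?thesis by simp
qed

text \<open>Resample from the conditional laws of \<open>\<nu>\<close> itself: on the samples of joint type \<open>\<nu>\<close> the density
  of the original law with respect to the new one is constant, equal to \<open>exp (- n * cond_entropy lam \<nu>)\<close>,
  and the new probability is at most \<open>1\<close>. A type that is not dominated by \<open>lam\<close> has probability \<open>0\<close>.\<close>
lemma measure_joint_type_le:
  fixes lam :: "('r::finite \<times> 's::finite) pmf"
  assumes n: "n \<ge> 1" and pos: "\<And>y. pmf (map_pmf snd lam) y > 0"
    and B: "B \<subseteq> {r \<in> {1..n} \<rightarrow>\<^sub>E UNIV. joint_type n r s = \<nu>}"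
    and c: "pmf_vec \<nu> \<in> dominated lam \<Longrightarrow> c \<le> cond_entropy lam (pmf_vec \<nu>)"
  shows "measure (product_law (theta lam) n s) B \<le> exp (- real n * c)"
proof (cases "pmf_vec \<nu> \<in> dominated lam")
  case False
  then obtain z where z: "pmf lam z = 0" "z \<in> set_pmf \<nu>"
    by (auto simp: pmf_vec_in_dominated set_pmf_iff)
  have ne: "{1..n} \<noteq> {}" using n by auto
  have "(\<Prod>i\<in>{1..n}. pmf (theta lam (s i)) (r i)) = 0" if "r \<in> B" for r
  proof -
    have "z \<in> set_pmf (joint_type n r s)" using that B z by auto
    then obtain i where "i \<in> {1..n}" "z = (r i, s i)"
      using ne by (auto simp: emp_measure_def set_pmf_of_set)
    then show ?thesis using z by (intro prod_zero) (auto simp: pmf_theta pos)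
  qed
  then have "measure (product_law (theta lam) n s) B = 0"
    using B by (subst measure_product_law) (auto intro!: sum.neutral)
  then show ?thesis by simp
next
  case True
  have S: "B \<subseteq> {1..n} \<rightarrow>\<^sub>E UNIV" using B by auto
  interpret P: prob_space "product_law (theta \<nu>) n s" by (rule prob_space_product_law)
  have density: "(\<Prod>i\<in>{1..n}. pmf (theta lam (s i)) (r i)) =
      (\<Prod>i\<in>{1..n}. pmf (theta \<nu> (s i)) (r i)) * exp (- real n * cond_entropy lam (pmf_vec \<nu>))"
    if "r \<in> B" for r
  proof -
    have \<nu>: "joint_type n r s = \<nu>" using that B by auto
    \<comment> \<open>Where the second marginal of \<open>\<nu>\<close> vanishes, \<open>theta \<nu>\<close> is arbitrary, but no sample of type \<open>\<nu>\<close>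
      meets such a point.\<close>
    have theta_\<nu>: "pmf (theta \<nu> (snd z)) (fst z) = pmf \<nu> z / pmf (map_pmf snd \<nu>) (snd z)"
      if "pmf \<nu> z > 0" for z
    proof -
      have "0 < pmf (map_pmf snd \<nu>) (snd z)"
        using that pmf_le_snd[of \<nu> "fst z" "snd z"] by auto
      then show ?thesis by (simp add: pmf_theta)
    qed
    have "pmf (theta \<nu> (s i)) (r i) > 0 \<and> pmf (theta lam (s i)) (r i) > 0" if "i \<in> {1..n}" for i
    proof -
      have "pmf \<nu> (r i, s i) > 0"
        using pmf_emp_measure_pos[OF that, of "\<lambda>i. (r i, s i)"] by (simp add: \<nu>)
      moreover from this have "pmf lam (r i, s i) > 0"
        using True by (auto simp: pmf_vec_in_dominated intro: pmf_pos)
      ultimately show ?thesis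
        using theta_\<nu>[of "(r i, s i)"] pmf_le_snd[of \<nu> "r i" "s i"] pos[of "s i"]
        by (auto simp: pmf_theta pos)
    qed
    then have "(\<Prod>i\<in>{1..n}. pmf (theta lam (s i)) (r i)) = (\<Prod>i\<in>{1..n}. pmf (theta \<nu> (s i)) (r i)) *
      exp (- real n * (\<Sum>z\<in>UNIV. pmf \<nu> z * ln (pmf (theta \<nu> (snd z)) (fst z) / pmf (theta lam (snd z)) (fst z))))"
      using change_of_measure[OF n, of "theta \<nu>" s r "theta lam"] by (simp add: \<nu>)
    also have "(\<Sum>z\<in>UNIV. pmf \<nu> z * ln (pmf (theta \<nu> (snd z)) (fst z) / pmf (theta lam (snd z)) (fst z)))
        = cond_entropy lam (pmf_vec \<nu>)"
      unfolding cond_entropy_eq_sum[OF True] snd_marginal_pmf_vec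
    proof (intro sum.cong refl)
      fix z
      show "pmf \<nu> z * ln (pmf (theta \<nu> (snd z)) (fst z) / pmf (theta lam (snd z)) (fst z)) =
        pmf_vec \<nu> $ z * ln (pmf_vec \<nu> $ z / pmf_vec (map_pmf snd \<nu>) $ snd z / (pmf lam z / pmf (map_pmf snd lam) (snd z)))"
        by (cases "pmf \<nu> z = 0") (use theta_\<nu>[of z] in \<open>auto simp: pmf_theta pos pmf_pos\<close>)
    qed
    finally show ?thesis .
  qed
  have "measure (product_law (theta lam) n s) B =
      measure (product_law (theta \<nu>) n s) B * exp (- real n * cond_entropy lam (pmf_vec \<nu>))"
    unfolding measure_product_law[OF S] sum_distrib_right by (intro sum.cong refl density)
  also have "\<dots> \<le> 1 * exp (- real n * c)"
    using c[OF True] by (intro mult_mono P.prob_le_1) (auto intro: mult_left_mono)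
  finally show ?thesis by simp
qed

text \<open>A type is given by its counts, each between \<open>0\<close> and \<open>n\<close>. The bound is polynomial in \<open>n\<close>, so it
  does not affect exponential rates.\<close>
lemma card_emp_measures:
  fixes R :: "'a::finite pmf set"
  assumes n: "n \<ge> 1" and R: "R \<subseteq> range (emp_measure n)"
  shows "finite R" and "card R \<le> (n + 1) ^ CARD('a)"
proof -
  let ?C = "UNIV \<rightarrow>\<^sub>E {..n} :: ('a \<Rightarrow> nat) set"
  define g where "g c = (SOME p :: 'a pmf. \<forall>x. pmf p x = real (c x) / real n)" for c :: "'a \<Rightarrow> nat"
  have "emp_measure n t \<in> g ` ?C" for t
  proof -
    let ?c = "\<lambda>x. card {i\<in>{1..n}. t i = x}"
    have "\<forall>x. pmf (g ?c) x = real (?c x) / real n"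
      unfolding g_def by (rule someI_ex) (intro exI[of _ "emp_measure n t"] allI pmf_emp_measure n)
    then have "emp_measure n t = g ?c"
      by (intro pmf_eqI) (simp add: pmf_emp_measure[OF n])
    moreover have "?c x \<le> n" for x
      using card_mono[of "{1..n}" "{i\<in>{1..n}. t i = x}", OF finite_atLeastAtMost] by (simp add: subset_eq)
    ultimately show ?thesis by auto
  qed
  then have sub: "R \<subseteq> g ` ?C" using R by auto
  have fin: "finite ?C" by (intro finite_PiE) auto
  show "finite R" by (rule finite_subset[OF sub finite_imageI[OF fin]])
  have "card R \<le> card (g ` ?C)" by (intro card_mono sub finite_imageI fin)
  also have "\<dots> \<le> card ?C" by (rule card_image_le[OF fin])
  also have "\<dots> = (n + 1) ^ CARD('a)" by (simp add: card_PiE)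
  finally show "card R \<le> (n + 1) ^ CARD('a)" .
qed

lemma measure_product_law_le:
  fixes lam :: "('r::finite \<times> 's::finite) pmf"
  assumes n: "n \<ge> 1" and pos: "\<And>y. pmf (map_pmf snd lam) y > 0"
    and B: "B \<subseteq> {1..n} \<rightarrow>\<^sub>E UNIV"
    and c: "\<And>r. r \<in> B \<Longrightarrow> pmf_vec (joint_type n r s) \<in> dominated lam \<Longrightarrow>
      c \<le> cond_entropy lam (pmf_vec (joint_type n r s))"
  shows "measure (product_law (theta lam) n s) B \<le> real (n + 1) ^ CARD('r \<times> 's) * exp (- real n * c)"
proof -
  interpret P: prob_space "product_law (theta lam) n s" by (rule prob_space_product_law)
  let ?R = "(\<lambda>r. joint_type n r s) ` B"
  have R: "finite ?R" "card ?R \<le> (n + 1) ^ CARD('r \<times> 's)"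
    using card_emp_measures[OF n, of ?R] by auto
  have "measure (product_law (theta lam) n s) B
      = measure (product_law (theta lam) n s) (\<Union>\<nu>\<in>?R. {r \<in> B. joint_type n r s = \<nu>})"
    by (rule arg_cong[where f="measure _"]) auto
  also have "\<dots> \<le> (\<Sum>\<nu>\<in>?R. measure (product_law (theta lam) n s) {r \<in> B. joint_type n r s = \<nu>})"
    by (rule P.finite_measure_subadditive_finite[OF R(1)])
      (use B in \<open>auto simp only: sets_PiM_pmf_finite[OF finite_atLeastAtMost]\<close>)
  also have "\<dots> \<le> (\<Sum>\<nu>\<in>?R. exp (- real n * c))"
  proof (intro sum_mono measure_joint_type_le[OF n pos])
    fix \<nu> assume "\<nu> \<in> ?R"
    then show "{r \<in> B. joint_type n r s = \<nu>} \<subseteq> {r \<in> {1..n} \<rightarrow>\<^sub>E UNIV. joint_type n r s = \<nu>}"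
      and "pmf_vec \<nu> \<in> dominated lam \<Longrightarrow> c \<le> cond_entropy lam (pmf_vec \<nu>)"
      using B c by auto
  qed
  also have "\<dots> = real (card ?R) * exp (- real n * c)" by simp
  also have "\<dots> \<le> real ((n + 1) ^ CARD('r \<times> 's)) * exp (- real n * c)"
    by (intro mult_right_mono of_nat_mono R(2) exp_ge_zero)
  finally show ?thesis by (simp only: of_nat_power)
qed

section \<open>The upper bound\<close>

lemma compact_range_pmf_vec: "compact (range (pmf_vec :: 'a::finite pmf \<Rightarrow> _))"
proof -
  have eq: "range (pmf_vec :: 'a pmf \<Rightarrow> _) = (\<Inter>x. {w. 0 \<le> w $ x}) \<inter> {w. (\<Sum>x\<in>UNIV. w $ x) = 1}"
    using ex_pmf_vec by (fastforce simp: sum_pmf_eq_1)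
  have "closed (range (pmf_vec :: 'a pmf \<Rightarrow> _))"
    unfolding eq
    by (intro closed_Int closed_INT ballI closed_Collect_le closed_Collect_eq continuous_intros)
  moreover have "range (pmf_vec :: 'a pmf \<Rightarrow> _) \<subseteq> cbox 0 1"
    by (auto simp: mem_box_cart pmf_le_1)
  then have "bounded (range (pmf_vec :: 'a pmf \<Rightarrow> _))"
    using bounded_cbox bounded_subset by blast
  ultimately show ?thesis by (simp add: compact_eq_bounded_closed)
qed

lemma tendsto_fst_marginal: "f \<longlonglongrightarrow> w \<Longrightarrow> (\<lambda>n. fst_marginal (f n)) \<longlonglongrightarrow> fst_marginal w"
  unfolding fst_marginal_def by (intro tendsto_intros)

lemma tendsto_snd_marginal: "f \<longlonglongrightarrow> w \<Longrightarrow> (\<lambda>n. snd_marginal (f n)) \<longlonglongrightarrow> snd_marginal w"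
  unfolding snd_marginal_def by (intro tendsto_intros)

text \<open>Compactness: joint distributions \<open>\<nu>\<close> that violate the bound for infinitely many \<open>n\<close> accumulate at a
  coupling with second marginal \<open>\<psi>\<close>, first marginal in the closure of \<open>A\<close> and entropy at most \<open>c\<close>.\<close>
lemma eventually_cond_entropy_ge:
  fixes lam :: "('r::finite \<times> 's::finite) pmf"
  assumes pos: "\<And>y. pmf (map_pmf snd lam) y > 0"
    and lim: "(\<lambda>n. pmf_vec (\<psi>s n)) \<longlonglongrightarrow> pmf_vec \<psi>"
    and c: "ereal c < (INF \<phi> \<in> weak_topology closure_of A. rate lam \<psi> \<phi>)"
  shows "eventually (\<lambda>n. \<forall>\<nu>. map_pmf fst \<nu> \<in> A \<longrightarrow> map_pmf snd \<nu> = \<psi>s n \<longrightarrow>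
    pmf_vec \<nu> \<in> dominated lam \<longrightarrow> c \<le> cond_entropy lam (pmf_vec \<nu>)) sequentially"
proof (rule ccontr)
  assume "\<not> ?thesis"
  from not_eventually_sequentiallyD[OF this] obtain k :: "nat \<Rightarrow> nat" where k: "strict_mono k"
    and "\<forall>n. \<exists>\<nu>. map_pmf fst \<nu> \<in> A \<and> map_pmf snd \<nu> = \<psi>s (k n) \<and>
      pmf_vec \<nu> \<in> dominated lam \<and> cond_entropy lam (pmf_vec \<nu>) < c"
    by (auto simp: not_le)
  then obtain \<nu> where \<nu>: "\<And>n. map_pmf fst (\<nu> n) \<in> A" "\<And>n. map_pmf snd (\<nu> n) = \<psi>s (k n)"
    "\<And>n. pmf_vec (\<nu> n) \<in> dominated lam" "\<And>n. cond_entropy lam (pmf_vec (\<nu> n)) < c"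
    by metis
  obtain w l where "w \<in> range (pmf_vec :: ('r \<times> 's) pmf \<Rightarrow> _)" and l: "strict_mono l"
    and to_w: "(\<lambda>n. pmf_vec (\<nu> (l n))) \<longlonglongrightarrow> w"
    using seq_compactE[OF compact_range_pmf_vec[unfolded compact_eq_seq_compact_metric], of "\<lambda>n. pmf_vec (\<nu> n)"]
    by (auto simp: o_def)
  then obtain \<xi> :: "('r \<times> 's) pmf" where to_\<xi>: "(\<lambda>n. pmf_vec (\<nu> (l n))) \<longlonglongrightarrow> pmf_vec \<xi>" by blast
  have dom: "pmf_vec \<xi> \<in> dominated lam"
    by (rule closed_sequentially[OF closed_dominated \<nu>(3) to_\<xi>])
  have "(\<lambda>n. pmf_vec (\<psi>s (k (l n)))) \<longlonglongrightarrow> pmf_vec (map_pmf snd \<xi>)"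
    using tendsto_snd_marginal[OF to_\<xi>] by (simp add: snd_marginal_pmf_vec \<nu>(2))
  moreover have "(\<lambda>n. pmf_vec (\<psi>s (k (l n)))) \<longlonglongrightarrow> pmf_vec \<psi>"
    using LIMSEQ_subseq_LIMSEQ[OF LIMSEQ_subseq_LIMSEQ[OF lim k] l] by (simp add: o_def)
  ultimately have "map_pmf snd \<xi> = \<psi>"
    using LIMSEQ_unique pmf_vec_inject by blast
  with dom have coup: "pmf_vec \<xi> \<in> couplings lam \<psi>"
    by (simp add: couplings_def snd_marginal_pmf_vec)
  have "map_pmf fst \<xi> \<in> weak_topology closure_of A"
    by (rule in_closure_of_weak_topologyI[OF \<nu>(1)[of "l _"]])
      (use tendsto_fst_marginal[OF to_\<xi>] in \<open>simp add: fst_marginal_pmf_vec\<close>)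
  then have "(INF \<phi> \<in> weak_topology closure_of A. rate lam \<psi> \<phi>) \<le> rate lam \<psi> (map_pmf fst \<xi>)"
    by (rule INF_lower)
  also have "\<dots> \<le> ereal (cond_entropy lam (pmf_vec \<xi>))"
    by (rule rate_le[OF pos coup fst_marginal_pmf_vec])
  finally have "c < cond_entropy lam (pmf_vec \<xi>)" using c by (metis ereal_less_eq(3) le_less_trans less_le_not_le linorder_not_less)
  moreover have "(\<lambda>n. cond_entropy lam (pmf_vec (\<nu> (l n)))) \<longlonglongrightarrow> cond_entropy lam (pmf_vec \<xi>)"
    by (rule continuous_on_tendsto_compose[OF continuous_on_cond_entropy to_\<xi> dom]) (simp add: \<nu>(3))
  then have "cond_entropy lam (pmf_vec \<xi>) \<le> c"
    by (rule LIMSEQ_le_const2) (use \<nu>(4) less_imp_le in blast)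
  ultimately show False by simp
qed

lemma log_prob_mono: "x \<le> y \<Longrightarrow> 0 \<le> x \<Longrightarrow> log_prob x \<le> log_prob y"
  by (auto simp: log_prob_def)

text \<open>Union bound over joint types, with the entropy of the types bounded below by compactness.\<close>
theorem product_law_upper_bound:
  fixes lam :: "('r::finite \<times> 's::finite) pmf" and s :: "nat \<Rightarrow> nat \<Rightarrow> 's"
  assumes pos: "\<And>y. pmf (map_pmf snd lam) y > 0"
    and lim: "(\<lambda>n. pmf_vec (emp_measure n (s n))) \<longlonglongrightarrow> pmf_vec \<psi>"
  shows "limsup (\<lambda>n. ereal (1 / real n) * log_prob (measure (product_law (theta lam) n (s n))
      {r \<in> {1..n} \<rightarrow>\<^sub>E UNIV. emp_measure n r \<in> A}))
    \<le> - (INF \<phi> \<in> weak_topology closure_of A. rate lam \<psi> \<phi>)" (is "?L \<le> - ?I")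
proof -
  let ?m = "\<lambda>n. measure (product_law (theta lam) n (s n)) {r \<in> {1..n} \<rightarrow>\<^sub>E UNIV. emp_measure n r \<in> A}"
  let ?K = "CARD('r \<times> 's)"
  have bound: "?L \<le> - ereal c" if c: "ereal c < ?I" for c
  proof -
    have "eventually (\<lambda>n. ereal (1 / real n) * log_prob (?m n) \<le> ereal (real ?K * ln (real (n + 1)) / real n - c)) sequentially"
      using eventually_cond_entropy_ge[OF pos lim c] eventually_ge_at_top[of 1]
    proof eventually_elim
      case (elim n)
      have "?m n \<le> real (n + 1) ^ ?K * exp (- real n * c)"
        by (rule measure_product_law_le[OF elim(2) pos])
          (use elim(1) in \<open>auto simp: map_fst_joint_type map_snd_joint_type\<close>)
      then have "log_prob (?m n) \<le> log_prob (real (n + 1) ^ ?K * exp (- real n * c))"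
        by (rule log_prob_mono) simp
      also have "\<dots> = ereal (real ?K * ln (real (n + 1)) - real n * c)"
        by (simp add: log_prob_def ln_mult ln_realpow)
      finally have "ereal (1 / real n) * log_prob (?m n) \<le> ereal (1 / real n) * \<dots>"
        by (rule ereal_mult_left_mono) simp
      also have "\<dots> = ereal (real ?K * ln (real (n + 1)) / real n - c)"
        using elim(2) by (simp add: field_simps)
      finally show ?case .
    qed
    then have "?L \<le> limsup (\<lambda>n. ereal (real ?K * ln (real (n + 1)) / real n - c))"
      by (rule Limsup_mono)
    also have "\<dots> = - ereal c"
    \<comment> \<open>The polynomial number of types costs only \<open>O(ln n / n)\<close>.\<close>
    proof -
      have "(\<lambda>n. real ?K * (ln (real (n + 1)) / real n) - c) \<longlonglongrightarrow> real ?K * 0 - c"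
        by (intro tendsto_intros) real_asymp
      then have "(\<lambda>n. ereal (real ?K * ln (real (n + 1)) / real n - c)) \<longlonglongrightarrow> - ereal c"
        by simp
      then show ?thesis by (intro lim_imp_Limsup) auto
    qed
    finally show ?thesis .
  qed
  have "?I \<le> - ?L"
  proof (rule dense_le)
    fix x assume x: "x < ?I"
    show "x \<le> - ?L"
    proof (cases x)
      case (real c)
      then have "- (- ?L) \<le> - x" using bound[of c] x by (simp only: ereal_uminus_uminus)
      then show ?thesis by (simp only: ereal_minus_le_minus)
    qed (use x in auto)
  qed
  then have "- (- ?L) \<le> - ?I" by (simp only: ereal_minus_le_minus)
  then show ?thesis by (simp only: ereal_uminus_uminus)
qed

section \<open>The lower bound\<close>

text \<open>A coordinate of the joint type is an average of independent indicators, with the stated mean, so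
  Hoeffding's inequality applies.\<close>
lemma pmf_joint_type_concentration:
  fixes \<kappa> :: "'s::finite \<Rightarrow> 'r::finite pmf"
  assumes n: "n \<ge> 1" and e: "e \<ge> 0"
  shows "measure (product_law \<kappa> n s) {r \<in> {1..n} \<rightarrow>\<^sub>E UNIV.
      \<bar>pmf (joint_type n r s) (x, y) - pmf (emp_measure n s) y * pmf (\<kappa> y) x\<bar> \<ge> e}
    \<le> 2 * exp (- 2 * real n * e\<^sup>2)"
proof -
  interpret P: finite_product_prob_space "\<lambda>i. measure_pmf (\<kappa> (s i))" "{1..n}"
    by unfold_locales simp
  let ?M = "product_law \<kappa> n s"
  let ?g = "\<lambda>i a. of_bool (a = x \<and> s i = y) :: real"
  let ?X = "\<lambda>i r. ?g i (r i) :: real"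
  have ne: "{1..n} \<noteq> {}" using n by auto
  have comp: "distr ?M (measure_pmf (\<kappa> (s i))) (\<lambda>r. r i) = measure_pmf (\<kappa> (s i))" if "i \<in> {1..n}" for i
    using P.PiM_component[OF that] .
  have "P.indep_vars (\<lambda>i. measure_pmf (\<kappa> (s i))) (\<lambda>i r. r i) {1..n}"
  proof (subst P.indep_vars_iff_distr_eq_PiM'[OF ne])
    have "distr ?M ?M (\<lambda>r. \<lambda>i\<in>{1..n}. r i) = distr ?M ?M (\<lambda>r. r)"
      by (rule distr_cong) (auto simp: space_PiM PiE_def extensional_restrict)
    also have "\<dots> = (\<Pi>\<^sub>M i\<in>{1..n}. distr ?M (measure_pmf (\<kappa> (s i))) (\<lambda>r. r i))"
      using comp by (subst distr_id2) (auto intro!: PiM_cong)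
    finally show "distr ?M ?M (\<lambda>r. \<lambda>i\<in>{1..n}. r i)
        = (\<Pi>\<^sub>M i\<in>{1..n}. distr ?M (measure_pmf (\<kappa> (s i))) (\<lambda>r. r i))" .
  qed (rule measurable_component_singleton)
  then have indep: "P.indep_vars (\<lambda>_. borel) ?X {1..n}"
    by (rule P.indep_vars_compose2) simp
  interpret H: Hoeffding_ineq ?M "{1..n}" ?X "\<lambda>_. 0" "\<lambda>_. 1" "\<Sum>i\<in>{1..n}. P.expectation (?X i)"
    by unfold_locales (use indep in auto)
  have "P.expectation (?X i) = of_bool (s i = y) * pmf (\<kappa> y) x" if i: "i \<in> {1..n}" for i
  proof -
    have "P.expectation (?X i) = (\<integral>a. ?g i a \<partial>distr ?M (measure_pmf (\<kappa> (s i))) (\<lambda>r. r i))"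
      by (rule integral_distr[symmetric]) (use i in \<open>auto intro: measurable_component_singleton\<close>)
    also have "\<dots> = measure_pmf.expectation (\<kappa> (s i)) (?g i)"
      by (simp only: comp[OF i])
    also have "\<dots> = of_bool (s i = y) * pmf (\<kappa> y) x"
      by (simp add: integral_measure_pmf_real[where A=UNIV] of_bool_def if_distrib[of "\<lambda>t. t * _"] cong: if_cong)
    finally show ?thesis .
  qed
  then have mean: "(\<Sum>i\<in>{1..n}. P.expectation (?X i)) = real n * (pmf (emp_measure n s) y * pmf (\<kappa> y) x)"
    using n by (simp add: pmf_emp_measure[OF n] Int_def flip: sum_distrib_right)
  have count: "(\<Sum>i\<in>{1..n}. ?X i r) = real n * pmf (joint_type n r s) (x, y)" for r
    using n by (simp add: pmf_emp_measure[OF n] Int_def)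
  have "\<bar>(\<Sum>i\<in>{1..n}. ?X i r) - (\<Sum>i\<in>{1..n}. P.expectation (?X i))\<bar> \<ge> real n * e \<longleftrightarrow>
      \<bar>pmf (joint_type n r s) (x, y) - pmf (emp_measure n s) y * pmf (\<kappa> y) x\<bar> \<ge> e" for r
    using n unfolding mean count by (simp add: abs_mult flip: right_diff_distrib)
  moreover have "measure ?M {r \<in> space ?M. \<bar>(\<Sum>i\<in>{1..n}. ?X i r) - (\<Sum>i\<in>{1..n}. P.expectation (?X i))\<bar> \<ge> real n * e}
      \<le> 2 * exp (-2 * (real n * e)\<^sup>2 / (\<Sum>i\<in>{1..n}. (1 - 0)\<^sup>2))"
    by (rule H.Hoeffding_ineq_abs_ge) (use n e in auto)
  moreover have "-2 * (real n * e)\<^sup>2 / (\<Sum>i\<in>{1..n}. (1 - 0)\<^sup>2) = - 2 * real n * e\<^sup>2"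
    using n by (simp add: power2_eq_square)
  ultimately show ?thesis by (simp add: space_PiM)
qed

text \<open>The joint type concentrates at its mean, which converges to \<open>\<xi>\<close>.\<close>
lemma joint_type_law_of_large_numbers:
  fixes \<kappa> :: "'s::finite \<Rightarrow> 'r::finite pmf" and s :: "nat \<Rightarrow> nat \<Rightarrow> 's"
  assumes lim: "(\<lambda>n. pmf_vec (emp_measure n (s n))) \<longlonglongrightarrow> pmf_vec \<psi>"
    and U: "open U" "pmf_vec \<xi> \<in> U" and \<xi>: "\<And>x y. pmf \<xi> (x, y) = pmf \<psi> y * pmf (\<kappa> y) x"
  shows "(\<lambda>n. measure (product_law \<kappa> n (s n))
      {r \<in> {1..n} \<rightarrow>\<^sub>E UNIV. pmf_vec (joint_type n r (s n)) \<in> U}) \<longlonglongrightarrow> 1"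
proof -
  obtain d where d: "d > 0" "ball (pmf_vec \<xi>) d \<subseteq> U"
    using U openE by blast
  define e where "e = d / (2 * real CARD('r \<times> 's))"
  have e: "e > 0" using d by (simp add: e_def)
  have box: "w \<in> U" if "\<And>z. \<bar>w $ z - pmf \<xi> z\<bar> < 2 * e" for w
  proof -
    have "norm (w - pmf_vec \<xi>) \<le> (\<Sum>z\<in>UNIV. \<bar>(w - pmf_vec \<xi>) $ z\<bar>)" by (rule norm_le_l1_cart)
    also have "\<dots> < (\<Sum>z\<in>(UNIV :: ('r \<times> 's) set). 2 * e)"
      by (rule sum_strict_mono) (use that in auto)
    also have "\<dots> = d" by (simp add: e_def)
    finally show ?thesis using d(2) by (auto simp: dist_norm norm_minus_commute)
  qed
  let ?bad = "\<lambda>n z. {r \<in> {1..n} \<rightarrow>\<^sub>E UNIV.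
      \<bar>pmf (joint_type n r (s n)) (fst z, snd z) - pmf (emp_measure n (s n)) (snd z) * pmf (\<kappa> (snd z)) (fst z)\<bar> \<ge> e}"
  let ?good = "\<lambda>n. {r \<in> {1..n} \<rightarrow>\<^sub>E UNIV. pmf_vec (joint_type n r (s n)) \<in> U}"
  have close: "eventually (\<lambda>n. \<forall>z. \<bar>pmf (emp_measure n (s n)) (snd z) * pmf (\<kappa> (snd z)) (fst z) - pmf \<xi> z\<bar> < e) sequentially"
  proof (rule eventually_all_finite)
    fix z :: "'r \<times> 's"
    have "(\<lambda>n. pmf (emp_measure n (s n)) (snd z)) \<longlonglongrightarrow> pmf \<psi> (snd z)"
      using tendsto_vec_nth[OF lim, of "snd z"] by simp
    then have "(\<lambda>n. pmf (emp_measure n (s n)) (snd z) * pmf (\<kappa> (snd z)) (fst z)) \<longlonglongrightarrow> pmf \<psi> (snd z) * pmf (\<kappa> (snd z)) (fst z)"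
      by (intro tendsto_intros)
    also have "pmf \<psi> (snd z) * pmf (\<kappa> (snd z)) (fst z) = pmf \<xi> z"
      using \<xi>[of "fst z" "snd z"] by simp
    finally show "eventually (\<lambda>n. \<bar>pmf (emp_measure n (s n)) (snd z) * pmf (\<kappa> (snd z)) (fst z) - pmf \<xi> z\<bar> < e) sequentially"
      using e by (simp add: tendsto_iff dist_real_def)
  qed
  have lower: "eventually (\<lambda>n. 1 - real CARD('r \<times> 's) * (2 * exp (- 2 * real n * e\<^sup>2))
      \<le> measure (product_law \<kappa> n (s n)) (?good n)) sequentially"
    using close eventually_ge_at_top[of 1]
  proof eventually_elim
    case (elim n)
    interpret P: prob_space "product_law \<kappa> n (s n)" by (rule prob_space_product_law)
    have sets: "sets (product_law \<kappa> n (s n)) = Pow ({1..n} \<rightarrow>\<^sub>E UNIV)"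
      by (rule sets_PiM_pmf_finite) simp
    have sp: "space (product_law \<kappa> n (s n)) = {1..n} \<rightarrow>\<^sub>E UNIV" by (simp add: space_PiM)
    have "1 - measure (product_law \<kappa> n (s n)) (?good n) = measure (product_law \<kappa> n (s n)) (({1..n} \<rightarrow>\<^sub>E UNIV) - ?good n)"
      using P.prob_compl[of "?good n"] unfolding sets sp by auto
    also have "\<dots> \<le> measure (product_law \<kappa> n (s n)) (\<Union>z\<in>UNIV. ?bad n z)"
    proof (rule P.finite_measure_mono)
      show "(\<Union>z\<in>UNIV. ?bad n z) \<in> P.events" unfolding sets by blast
      show "({1..n} \<rightarrow>\<^sub>E UNIV) - ?good n \<subseteq> (\<Union>z\<in>UNIV. ?bad n z)"
      proof
        fix r assume r: "r \<in> ({1..n} \<rightarrow>\<^sub>E UNIV) - ?good n"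
        then have "pmf_vec (joint_type n r (s n)) \<notin> U" by simp
        then obtain z where z: "\<not> \<bar>pmf (joint_type n r (s n)) z - pmf \<xi> z\<bar> < 2 * e"
          using box by fastforce
        have "e \<le> \<bar>pmf (joint_type n r (s n)) z - pmf (emp_measure n (s n)) (snd z) * pmf (\<kappa> (snd z)) (fst z)\<bar>"
          using z elim(1)[rule_format, of z] by linarith
        then show "r \<in> (\<Union>z\<in>UNIV. ?bad n z)" using r by (intro UN_I[of z]) auto
      qed
    qed
    also have "\<dots> \<le> (\<Sum>z\<in>UNIV. measure (product_law \<kappa> n (s n)) (?bad n z))"
      by (rule P.finite_measure_subadditive_finite[OF finite]) (auto simp only: sets)
    also have "\<dots> \<le> (\<Sum>z\<in>(UNIV :: ('r \<times> 's) set). 2 * exp (- 2 * real n * e\<^sup>2))"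
      using elim(2) e by (intro sum_mono pmf_joint_type_concentration) auto
    finally show ?case by simp
  qed
  show ?thesis
  proof (rule tendsto_sandwich[OF lower])
    show "eventually (\<lambda>n. measure (product_law \<kappa> n (s n)) (?good n) \<le> 1) sequentially"
      by (intro always_eventually allI prob_space.prob_le_1 prob_space_product_law)
    have "(\<lambda>n. exp (- 2 * real n * e\<^sup>2)) \<longlonglongrightarrow> 0" using e by real_asymp
    then have "(\<lambda>n. 1 - real CARD('r \<times> 's) * (2 * exp (- 2 * real n * e\<^sup>2))) \<longlonglongrightarrow> 1 - real CARD('r \<times> 's) * (2 * 0)"
      by (intro tendsto_intros)
    then show "(\<lambda>n. 1 - real CARD('r \<times> 's) * (2 * exp (- 2 * real n * e\<^sup>2))) \<longlonglongrightarrow> 1" by simp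
  qed simp
qed

text \<open>Sampling from \<open>\<theta>\<close> instead of \<open>\<kappa>\<close> costs at most the mean log-density under the joint type, which
  is linear in the type. It is therefore controlled on every neighbourhood of the type one aims for.\<close>
lemma product_law_tilt:
  fixes \<kappa> \<theta> :: "'s::finite \<Rightarrow> 'r::finite pmf"
  assumes n: "n \<ge> 1" and ac: "\<And>x y. pmf (\<kappa> y) x > 0 \<Longrightarrow> pmf (\<theta> y) x > 0"
    and B: "B \<subseteq> {1..n} \<rightarrow>\<^sub>E UNIV"
    and c: "\<And>r. r \<in> B \<Longrightarrow> (\<Sum>z\<in>UNIV. pmf (joint_type n r s) z * ln (pmf (\<kappa> (snd z)) (fst z) / pmf (\<theta> (snd z)) (fst z))) \<le> c"
  shows "measure (product_law \<kappa> n s) B * exp (- real n * c) \<le> measure (product_law \<theta> n s) B"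
  unfolding measure_product_law[OF B] sum_distrib_right
proof (rule sum_mono)
  fix r assume r: "r \<in> B"
  show "(\<Prod>i\<in>{1..n}. pmf (\<kappa> (s i)) (r i)) * exp (- real n * c) \<le> (\<Prod>i\<in>{1..n}. pmf (\<theta> (s i)) (r i))"
  proof (cases "\<forall>i\<in>{1..n}. pmf (\<kappa> (s i)) (r i) > 0")
    case True
    have "exp (- real n * c) \<le> exp (- real n * (\<Sum>z\<in>UNIV. pmf (joint_type n r s) z *
        ln (pmf (\<kappa> (snd z)) (fst z) / pmf (\<theta> (snd z)) (fst z))))"
      using c[OF r] by (simp add: mult_left_mono)
    then have "(\<Prod>i\<in>{1..n}. pmf (\<kappa> (s i)) (r i)) * exp (- real n * c)
        \<le> (\<Prod>i\<in>{1..n}. pmf (\<kappa> (s i)) (r i)) * exp (- real n * (\<Sum>z\<in>UNIV. pmf (joint_type n r s) z *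
        ln (pmf (\<kappa> (snd z)) (fst z) / pmf (\<theta> (snd z)) (fst z))))"
      by (intro mult_left_mono prod_nonneg) auto
    also have "\<dots> = (\<Prod>i\<in>{1..n}. pmf (\<theta> (s i)) (r i))"
      by (rule change_of_measure[OF n, symmetric]) (use True ac in blast)+
    finally show ?thesis .
  next
    case False
    then obtain i where "i \<in> {1..n}" "pmf (\<kappa> (s i)) (r i) = 0" by (auto simp: pmf_eq_0_set_pmf pmf_positive_iff)
    then have "(\<Prod>i\<in>{1..n}. pmf (\<kappa> (s i)) (r i)) = 0" by (intro prod_zero) auto
    then have "(\<Prod>i\<in>{1..n}. pmf (\<kappa> (s i)) (r i)) * exp (- real n * c) = 0" by (simp only: mult_zero_left)
    then show ?thesis by (metis pmf_nonneg prod_nonneg)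
  qed
qed

text \<open>For each \<open>\<phi>\<close> in the interior, tilt the law to the conditional laws of a minimising coupling. Under the
  tilted law the joint type is near that coupling with probability tending to \<open>1\<close>, which puts the
  empirical measure into \<open>A\<close>, at an exponential cost arbitrarily close to the rate.\<close>
theorem product_law_lower_bound:
  fixes lam :: "('r::finite \<times> 's::finite) pmf" and s :: "nat \<Rightarrow> nat \<Rightarrow> 's"
  assumes pos: "\<And>y. pmf (map_pmf snd lam) y > 0"
    and lim: "(\<lambda>n. pmf_vec (emp_measure n (s n))) \<longlonglongrightarrow> pmf_vec \<psi>"
  shows "liminf (\<lambda>n. ereal (1 / real n) * log_prob (measure (product_law (theta lam) n (s n))
      {r \<in> {1..n} \<rightarrow>\<^sub>E UNIV. emp_measure n r \<in> A}))
    \<ge> - (INF \<phi> \<in> weak_topology interior_of A. rate lam \<psi> \<phi>)" (is "?L \<ge> - ?I")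
proof -
  let ?m = "\<lambda>n. measure (product_law (theta lam) n (s n)) {r \<in> {1..n} \<rightarrow>\<^sub>E UNIV. emp_measure n r \<in> A}"
  have point: "- ?L \<le> rate lam \<psi> \<phi>" if \<phi>: "\<phi> \<in> weak_topology interior_of A" for \<phi>
  proof (cases "rate lam \<psi> \<phi> < \<infinity>")
    case True
    then obtain w where w: "w \<in> couplings lam \<psi>" "fst_marginal w = pmf_vec \<phi>"
      and rate: "rate lam \<psi> \<phi> = ereal (cond_entropy lam w)"
      using rate_attained[OF pos] by metis
    obtain \<xi> where \<xi>: "w = pmf_vec \<xi>" using w(1) by (rule couplings_imp_pmf_vec)
    have snd: "map_pmf snd \<xi> = \<psi>" and dom: "pmf_vec \<xi> \<in> dominated lam"
      using w(1) by (simp_all add: \<xi> pmf_vec_in_couplings pmf_vec_in_dominated)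
    \<comment> \<open>Where \<open>\<psi>\<close> vanishes \<open>theta \<xi>\<close> is an arbitrary distribution, but \<open>s n\<close> may still visit such
      points, so there \<open>theta lam\<close> is used to keep absolute continuity.\<close>
    define \<kappa> where "\<kappa> y = (if pmf \<psi> y > 0 then theta \<xi> y else theta lam y)" for y
    have \<kappa>1: "pmf (\<kappa> y) x = pmf \<xi> (x, y) / pmf \<psi> y" if "pmf \<psi> y > 0" for x y
      using that by (simp add: \<kappa>_def pmf_theta snd)
    have \<xi>_eq: "pmf \<xi> (x, y) = pmf \<psi> y * pmf (\<kappa> y) x" for x y
    proof (cases "pmf \<psi> y = 0")
      case True
      then show ?thesis using pmf_le_snd[of \<xi> x y] by (simp add: snd)
    next
      case False
      then show ?thesis using \<kappa>1[of y x] pmf_nonneg[of \<psi> y] by simp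
    qed
    have ac: "pmf (theta lam y) x > 0" if "pmf (\<kappa> y) x > 0" for x y
    proof (cases "pmf \<psi> y > 0")
      case True
      then have "pmf \<xi> (x, y) > 0" using that by (simp add: \<xi>_eq)
      then have "pmf lam (x, y) > 0"
        using dom by (auto simp: pmf_vec_in_dominated intro: pmf_pos)
      then show ?thesis by (simp add: pmf_theta pos)
    qed (use that in \<open>simp add: \<kappa>_def\<close>)
    define F where "F z = ln (pmf (\<kappa> (snd z)) (fst z) / pmf (theta lam (snd z)) (fst z))" for z
    have F: "(\<Sum>z\<in>UNIV. pmf \<xi> z * F z) = cond_entropy lam w"
      unfolding \<xi> cond_entropy_eq_sum[OF dom] snd_marginal_pmf_vec snd
    proof (intro sum.cong refl)
      fix z :: "'r \<times> 's"
      obtain x y where z: "z = (x, y)" by force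
      show "pmf \<xi> z * F z = pmf_vec \<xi> $ z * ln (pmf_vec \<xi> $ z / pmf_vec \<psi> $ snd z / (pmf lam z / pmf (map_pmf snd lam) (snd z)))"
      proof (cases "pmf \<psi> y > 0")
        case True
        then show ?thesis by (simp add: z F_def \<kappa>1 pmf_theta pos)
      next
        case False
        then have "pmf \<xi> z = 0" using pmf_nonneg[of \<psi> y] by (simp add: z \<xi>_eq)
        then show ?thesis by simp
      qed
    qed
    obtain V where V: "open V" "weak_topology interior_of A = pmf_vec -` V"
      using openin_interior_of[of weak_topology A] unfolding openin_weak_topology by blast
    have bound: "- ereal (cond_entropy lam w + e) \<le> ?L" if e: "e > 0" for e
    proof -
      define c where "c = cond_entropy lam w + e"
      \<comment> \<open>The first condition puts the empirical measure into \<open>A\<close>, the second bounds the cost.\<close>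
      define U where "U = {u. fst_marginal u \<in> V} \<inter> {u. (\<Sum>z\<in>UNIV. u $ z * F z) < c}"
      have "open U"
        unfolding U_def using V(1)
        by (intro open_Int open_Collect_less continuous_intros)
          (auto intro!: open_vimage[unfolded vimage_def] continuous_intros)
      moreover have "pmf_vec \<xi> \<in> U"
        using \<phi> w(2) V(2) F e by (auto simp: U_def \<xi> c_def)
      ultimately have lln: "(\<lambda>n. measure (product_law \<kappa> n (s n))
          {r \<in> {1..n} \<rightarrow>\<^sub>E UNIV. pmf_vec (joint_type n r (s n)) \<in> U}) \<longlonglongrightarrow> 1"
        using joint_type_law_of_large_numbers[OF lim _ _ \<xi>_eq] by blast
      have half_less_one: "1 / 2 < (1 :: real)" by simp
      have "eventually (\<lambda>n. ereal (- ln 2 / real n - c) \<le> ereal (1 / real n) * log_prob (?m n)) sequentially"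
        using order_tendstoD(1)[OF lln half_less_one] eventually_ge_at_top[of 1]
      proof eventually_elim
        case (elim n)
        let ?B = "{r \<in> {1..n} \<rightarrow>\<^sub>E UNIV. pmf_vec (joint_type n r (s n)) \<in> U}"
        interpret P: prob_space "product_law (theta lam) n (s n)" by (rule prob_space_product_law)
        have "1 / 2 * exp (- real n * c) \<le> measure (product_law \<kappa> n (s n)) ?B * exp (- real n * c)"
          using elim(1) by (intro mult_right_mono) auto
        also have "\<dots> \<le> measure (product_law (theta lam) n (s n)) ?B"
          by (rule product_law_tilt[OF elim(2) ac]) (auto simp: U_def F_def)
        also have "\<dots> \<le> ?m n"
        proof (rule P.finite_measure_mono)
          show "{r \<in> {1..n} \<rightarrow>\<^sub>E UNIV. emp_measure n r \<in> A} \<in> P.events"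
            unfolding sets_PiM_pmf_finite[OF finite_atLeastAtMost] by blast
          have "emp_measure n r \<in> A" if "pmf_vec (joint_type n r (s n)) \<in> U" for r
          proof -
            have "emp_measure n r \<in> weak_topology interior_of A"
              using that by (simp add: U_def V(2) fst_marginal_pmf_vec map_fst_joint_type)
            then show ?thesis by (rule subsetD[OF interior_of_subset])
          qed
          then show "?B \<subseteq> {r \<in> {1..n} \<rightarrow>\<^sub>E UNIV. emp_measure n r \<in> A}" by blast
        qed
        finally have "log_prob (1 / 2 * exp (- real n * c)) \<le> log_prob (?m n)"
          by (rule log_prob_mono) simp
        moreover have "log_prob (1 / 2 * exp (- real n * c)) = ereal (- ln 2 - real n * c)"
          by (simp add: log_prob_def ln_mult ln_div)
        ultimately have "ereal (1 / real n) * ereal (- ln 2 - real n * c) \<le> ereal (1 / real n) * log_prob (?m n)"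
          by (intro ereal_mult_left_mono) auto
        moreover have "1 / real n * (- ln 2 - real n * c) = - ln 2 / real n - c"
          using elim(2) by (simp add: field_simps)
        ultimately show ?case by (simp only: times_ereal.simps)
      qed
      then have "liminf (\<lambda>n. ereal (- ln 2 / real n - c)) \<le> ?L"
        by (rule Liminf_mono)
      moreover have "(\<lambda>n. ereal (- ln 2 / real n - c)) \<longlonglongrightarrow> ereal (- c)"
        by (rule tendsto_ereal) real_asymp
      then have "liminf (\<lambda>n. ereal (- ln 2 / real n - c)) = ereal (- c)"
        by (intro lim_imp_Liminf) auto
      ultimately show ?thesis by (simp add: c_def)
    qed
    have "- ?L \<le> ereal (cond_entropy lam w)"
    proof (rule ereal_le_epsilon2)
      fix e :: real assume "0 < e"
      from bound[OF this] show "- ?L \<le> ereal (cond_entropy lam w) + ereal e"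
        by (simp add: ereal_uminus_le_reorder)
    qed
    then show ?thesis by (simp add: rate)
  qed auto
  have "- ?L \<le> ?I" by (rule INF_greatest[OF point])
  then show ?thesis by (simp add: ereal_uminus_le_reorder)
qed

section \<open>The large deviation principle\<close>

theorem theorem8p2:
  fixes lam :: "('r::finite \<times> 's::finite) pmf"
    and \<psi> :: "'s pmf" and \<psi>s :: "nat \<Rightarrow> 's pmf"
  assumes "\<And>s. measure_pmf.prob lam (UNIV \<times> {s}) > 0"
    and "(INF \<xi> \<in> marginals -` (UNIV \<times> {\<psi>}). rel_entropy \<xi> lam) < \<infinity>"
    and "\<And>n. n \<ge> 1 \<Longrightarrow> \<psi>s n \<in> emp_measures n"
    and "limitin weak_topology \<psi>s \<psi> sequentially"
  shows "satisfies_LDP weak_topology (\<lambda>n. eta lam n (\<psi>s n)) (rate lam \<psi>) \<and>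
         continuous_map (subtopology weak_topology {\<phi>. rate lam \<psi> \<phi> < \<infinity>}) euclidean (rate lam \<psi>)"
proof
  have pos: "pmf (map_pmf snd lam) y > 0" for y
  proof -
    have "UNIV \<times> {y} = snd -` {y}" by auto
    then show ?thesis using assms(1)[of y] unfolding pmf_map by (rule subst)
  qed
  show "continuous_map (subtopology weak_topology {\<phi>. rate lam \<psi> \<phi> < \<infinity>}) euclidean (rate lam \<psi>)"
    by (rule continuous_map_rate[OF pos])
  have "\<forall>n. \<exists>t. n \<ge> 1 \<longrightarrow> t \<in> {1..n} \<rightarrow>\<^sub>E UNIV \<and> \<psi>s n = emp_measure n t"
    using assms(3) unfolding emp_measures_def by blast
  then obtain s where s: "\<And>n. n \<ge> 1 \<Longrightarrow> s n \<in> {1..n} \<rightarrow>\<^sub>E UNIV \<and> \<psi>s n = emp_measure n (s n)"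
    by metis
  \<comment> \<open>The value of \<open>s 0\<close> is arbitrary, so the sequences agree only from \<open>1\<close> on.\<close>
  have lim: "(\<lambda>n. pmf_vec (emp_measure n (s n))) \<longlonglongrightarrow> pmf_vec \<psi>"
  proof (rule Lim_transform_eventually[OF limitin_weak_topology_pmf_vec[OF assms(4)]])
    show "eventually (\<lambda>n. pmf_vec (\<psi>s n) = pmf_vec (emp_measure n (s n))) sequentially"
      using eventually_ge_at_top[of 1] by eventually_elim (simp add: s)
  qed
  have eta: "eta lam n (\<psi>s n) = emp_law lam n (s n)" if "n \<ge> 1" for n
    using eta_emp_measure[OF that] s[OF that] by metis
  have law: "measure (eta lam n (\<psi>s n)) A =
      measure (product_law (theta lam) n (s n)) {r \<in> {1..n} \<rightarrow>\<^sub>E UNIV. emp_measure n r \<in> A}"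
    if "n \<ge> 1" "A \<in> sets (borel_of_topology weak_topology)" for n A
    unfolding eta[OF that(1)] measure_def emeasure_emp_law[OF that(2)] ..
  show "satisfies_LDP weak_topology (\<lambda>n. eta lam n (\<psi>s n)) (rate lam \<psi>)"
    unfolding satisfies_LDP_def
  proof (intro conjI ballI allI impI)
    show "0 \<le> rate lam \<psi> x" for x by (rule rate_nonneg[OF pos])
    show "lower_semicontinuous weak_topology (rate lam \<psi>)" by (rule lower_semicontinuous_rate[OF pos])
  next
    fix n :: nat assume n: "n \<ge> 1"
    show "prob_space (eta lam n (\<psi>s n))"
      unfolding eta[OF n] emp_law_def
      by (rule prob_space.prob_space_distr[OF prob_space_product_law measurable_emp_measure])
    show "space (eta lam n (\<psi>s n)) = topspace weak_topology"
      by (simp add: eta[OF n] emp_law_def borel_of_topology_def space_measure_of_conv)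
    show "sets (eta lam n (\<psi>s n)) = sets (borel_of_topology weak_topology)"
      by (simp add: eta[OF n] emp_law_def)
  next
    fix A :: "'r pmf set" assume A: "A \<in> sets (borel_of_topology weak_topology)"
    have eq: "eventually (\<lambda>n. ereal (1 / real n) * log_prob (measure (eta lam n (\<psi>s n)) A) =
        ereal (1 / real n) * log_prob (measure (product_law (theta lam) n (s n))
          {r \<in> {1..n} \<rightarrow>\<^sub>E UNIV. emp_measure n r \<in> A})) sequentially"
      using eventually_ge_at_top[of 1] by eventually_elim (simp only: law[OF _ A])
    show "- (INF x \<in> weak_topology interior_of A. rate lam \<psi> x)
        \<le> liminf (\<lambda>n. ereal (1 / real n) * log_prob (measure (eta lam n (\<psi>s n)) A))"
      unfolding Liminf_eq[OF eq] by (rule product_law_lower_bound[OF pos lim])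
    show "limsup (\<lambda>n. ereal (1 / real n) * log_prob (measure (eta lam n (\<psi>s n)) A))
        \<le> - (INF x \<in> weak_topology closure_of A. rate lam \<psi> x)"
      unfolding Limsup_eq[OF eq] by (rule product_law_upper_bound[OF pos lim])
  qed
qed

end
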